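(* The following decision problem (MLCM-P\_PATH CROSSING) is solvable in polynomial time: given $n\ge 2$ and a finite set $\mathcal L$ of pairwise distinct lines on the path with stations $1,\dots,n$, decide whether there exists an admissible layout of $\mathcal L$ satisfying the periphery condition whose crossing number is $0$.
   Context: Stations $1,\dots,n$ lie in this order on a horizontal line; consecutive stations are joined by edges $(i,i+1)$, $1\le i<n$. A line is a pair $[i,j]$ of integers with $1\le i<j\le n$ (left end $i$, right end $j$); it travels along the edges $(i,i+1),\dots,(j-1,j)$. For an edge $(i,i+1)$, $\mathcal L_{i,i+1}$ denotes the set of lines of $\mathcal L$ traversing it. A line $[a,b]$ passes through station $i$ if $a<i<b$. A layout of $\mathcal L$ specifies, for every edge $(i,i+1)$, a top-to-bottom order of $\mathcal L_{i,i+1}$ at the end of the edge at station $i$ and a top-to-bottom order of $\mathcal L_{i,i+1}$ at the end of the edge at station $i+1$. Two lines cross on edge $(i,i+1)$ if their relative order differs at the two ends of that edge; the crossing number of a layout is the total number of pairs (unordered pair of lines, edge) such that the two lines cross on that edge. A layout is admissible if for every station $i$ and any two lines passing through $i$, their relative order at the station-$i$ end of edge $(i-1,i)$ equals their relative order at the station-$i$ end of edge $(i,i+1)$. A layout satisfies the periphery condition if for every line $[a,b]$: at the station-$a$ end of edge $(a,a+1)$ the line is above all or below all lines of $\mathcal L_{a,a+1}$ that pass through $a$, and at the station-$b$ end of edge $(b-1,b)$ it is above all or below all lines of $\mathcal L_{b-1,b}$ that pass through $b$. *)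

theory Defs
  imports
    Complex_Main
    "HOL-Library.Log_Nat"
    "HOL-Computational_Algebra.Polynomial"
begin

section \<open>Polynomial time\<close>

text \<open>
  The machine model is the random access machine with a read-only input tape under the
  \<^emph>\<open>logarithmic\<close> cost criterion (Aho, Hopcroft, Ullman), which is polynomially
  equivalent to Turing machines.  Registers hold natural numbers and are all \<open>0\<close> initially;
  there is no multiplication, and \<open>Sub\<close> is truncated, so \<open>x < y\<close> is tested by
  \<open>y - x \<noteq> 0\<close>.  \<open>Load r s\<close> is \<open>R[r] := R[R[s]]\<close> and
  \<open>Store r s\<close> is \<open>R[R[r]] := R[s]\<close>.
\<close>

datatype instr =
    Const nat nat
  | Copy nat nat
  | Add nat nat nat
  | Sub nat nat nat
  | Load nat nat
  | Store nat nat
  | Read nat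
  | Jump nat
  | JumpZero nat nat
  | Halt bool

text \<open>A configuration: program counter, register contents, unread part of the input.\<close>

type_synonym config = "nat \<times> (nat \<Rightarrow> nat) \<times> nat list"

text \<open>Reading past the end of the input yields \<open>0\<close>.\<close>

definition next_input :: "nat list \<Rightarrow> nat" where
  "next_input w = (case w of [] \<Rightarrow> 0 | x # _ \<Rightarrow> x)"

fun step :: "instr \<Rightarrow> config \<Rightarrow> config" where
  "step (Const r c) (pc, R, w) = (Suc pc, R(r := c), w)"
| "step (Copy r s) (pc, R, w) = (Suc pc, R(r := R s), w)"
| "step (Add r s t) (pc, R, w) = (Suc pc, R(r := R s + R t), w)"
| "step (Sub r s t) (pc, R, w) = (Suc pc, R(r := R s - R t), w)"
| "step (Load r s) (pc, R, w) = (Suc pc, R(r := R (R s)), w)"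
| "step (Store r s) (pc, R, w) = (Suc pc, R(R r := R s), w)"
| "step (Read r) (pc, R, w) = (Suc pc, R(r := next_input w), tl w)"
| "step (Jump k) (pc, R, w) = (k, R, w)"
| "step (JumpZero r k) (pc, R, w) = (if R r = 0 then k else Suc pc, R, w)"
| "step (Halt b) (pc, R, w) = (pc, R, w)"

text \<open>Number of binary digits, where \<open>0\<close> is written with one digit.\<close>

definition bit_size :: "nat \<Rightarrow> nat" where
  "bit_size x = max 1 (floorlog 2 x)"

text \<open>An instruction is charged for the length of every address and every operand it uses.\<close>

fun step_cost :: "instr \<Rightarrow> config \<Rightarrow> nat" where
  "step_cost (Const r c) (pc, R, w) = bit_size r + bit_size c"
| "step_cost (Copy r s) (pc, R, w) = bit_size r + bit_size s + bit_size (R s)"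
| "step_cost (Add r s t) (pc, R, w) =
    bit_size r + bit_size s + bit_size (R s) + bit_size t + bit_size (R t)"
| "step_cost (Sub r s t) (pc, R, w) =
    bit_size r + bit_size s + bit_size (R s) + bit_size t + bit_size (R t)"
| "step_cost (Load r s) (pc, R, w) =
    bit_size r + bit_size s + bit_size (R s) + bit_size (R (R s))"
| "step_cost (Store r s) (pc, R, w) =
    bit_size r + bit_size (R r) + bit_size s + bit_size (R s)"
| "step_cost (Read r) (pc, R, w) = bit_size r + bit_size (next_input w)"
| "step_cost (Jump k) (pc, R, w) = 1"
| "step_cost (JumpZero r k) (pc, R, w) = bit_size r + bit_size (R r)"
| "step_cost (Halt b) (pc, R, w) = 1"

text \<open>
  \<open>halts_with P c t b\<close>: started in \<open>c\<close>, the program \<open>P\<close> reaches a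
  \<open>Halt b\<close> instruction at total cost \<open>t\<close>.  A run whose program counter leaves
  the program is stuck and has no answer.
\<close>

inductive halts_with :: "instr list \<Rightarrow> config \<Rightarrow> nat \<Rightarrow> bool \<Rightarrow> bool" for P where
  halt: "fst c < length P \<Longrightarrow> P ! fst c = Halt b \<Longrightarrow>
    halts_with P c (step_cost (P ! fst c) c) b"
| run: "fst c < length P \<Longrightarrow> \<forall>b'. P ! fst c \<noteq> Halt b' \<Longrightarrow>
    halts_with P (step (P ! fst c) c) t b \<Longrightarrow>
    halts_with P c (step_cost (P ! fst c) c + t) b"

definition input_size :: "nat list \<Rightarrow> nat" where
  "input_size w = (\<Sum>x\<leftarrow>w. bit_size x)"

text \<open>
  The problem \<open>Q\<close> on the instances \<open>I\<close>; \<open>enc x w\<close> says that the word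
  \<open>w\<close> is an encoding of the instance \<open>x\<close>.  An instance may have several
  encodings, and the machine must answer correctly on each of them.
\<close>

definition poly_time_decidable ::
  "'a set \<Rightarrow> ('a \<Rightarrow> nat list \<Rightarrow> bool) \<Rightarrow> ('a \<Rightarrow> bool) \<Rightarrow> bool" where
  "poly_time_decidable I enc Q \<longleftrightarrow>
    (\<exists>(P :: instr list) (p :: nat poly). \<forall>x\<in>I. \<forall>w. enc x w \<longrightarrow>
      (\<exists>t. halts_with P (0, (\<lambda>_. 0), w) t (Q x) \<and> t \<le> poly p (input_size w)))"


section \<open>Lines on a path and their layouts\<close>

type_synonym line = "nat \<times> nat"

definition is_line :: "nat \<Rightarrow> line \<Rightarrow> bool" where
  "is_line n l \<longleftrightarrow> 1 \<le> fst l \<and> fst l < snd l \<and> snd l \<le> n"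

text \<open>The edge \<open>(i, i + 1)\<close> is represented by its left station \<open>i\<close>.\<close>

definition lines_on_edge :: "line set \<Rightarrow> nat \<Rightarrow> line set" where
  "lines_on_edge L i = {l \<in> L. fst l \<le> i \<and> i + 1 \<le> snd l}"

definition passes_through :: "line \<Rightarrow> nat \<Rightarrow> bool" where
  "passes_through l i \<longleftrightarrow> fst l < i \<and> i < snd l"

text \<open>
  For a layout \<open>\<phi>\<close>, the relation \<open>\<phi> i s\<close> is the (reflexive) top-to-bottom order
  on the edge \<open>(i, i + 1)\<close> at its end at station \<open>s\<close>, where \<open>s\<close> is
  \<open>i\<close> or \<open>i + 1\<close>; a pair \<open>(l, l')\<close> of distinct lines is in it if \<open>l\<close>
  is above \<open>l'\<close>.
\<close>

type_synonym layout = "nat \<Rightarrow> nat \<Rightarrow> line rel"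

definition is_layout :: "nat \<Rightarrow> line set \<Rightarrow> layout \<Rightarrow> bool" where
  "is_layout n L \<phi> \<longleftrightarrow>
    (\<forall>i. 1 \<le> i \<and> i < n \<longrightarrow>
      linear_order_on (lines_on_edge L i) (\<phi> i i) \<and>
      linear_order_on (lines_on_edge L i) (\<phi> i (i + 1)))"

definition cross_on_edge :: "layout \<Rightarrow> nat \<Rightarrow> line \<Rightarrow> line \<Rightarrow> bool" where
  "cross_on_edge \<phi> i l l' \<longleftrightarrow> ((l, l') \<in> \<phi> i i \<longleftrightarrow> (l, l') \<notin> \<phi> i (i + 1))"

definition crossing_number :: "nat \<Rightarrow> line set \<Rightarrow> layout \<Rightarrow> nat" where
  "crossing_number n L \<phi> =
    card {({l, l'}, i) | l l' i. 1 \<le> i \<and> i < n \<and> l \<in> lines_on_edge L i \<and>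
      l' \<in> lines_on_edge L i \<and> l \<noteq> l' \<and> cross_on_edge \<phi> i l l'}"

definition admissible :: "nat \<Rightarrow> line set \<Rightarrow> layout \<Rightarrow> bool" where
  "admissible n L \<phi> \<longleftrightarrow>
    (\<forall>i\<in>{1..n}. \<forall>l\<in>L. \<forall>l'\<in>L. passes_through l i \<and> passes_through l' i \<longrightarrow>
      ((l, l') \<in> \<phi> (i - 1) i \<longleftrightarrow> (l, l') \<in> \<phi> i i))"

text \<open>The line \<open>l\<close> is outermost at the end at \<open>s\<close> of the edge \<open>(i, i + 1)\<close>.\<close>

definition at_periphery :: "line set \<Rightarrow> layout \<Rightarrow> line \<Rightarrow> nat \<Rightarrow> nat \<Rightarrow> bool" where
  "at_periphery L \<phi> l i s \<longleftrightarrow>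
    (\<forall>l'\<in>lines_on_edge L i. passes_through l' s \<longrightarrow> (l, l') \<in> \<phi> i s) \<or>
    (\<forall>l'\<in>lines_on_edge L i. passes_through l' s \<longrightarrow> (l', l) \<in> \<phi> i s)"

definition periphery_condition :: "line set \<Rightarrow> layout \<Rightarrow> bool" where
  "periphery_condition L \<phi> \<longleftrightarrow>
    (\<forall>(a, b)\<in>L. at_periphery L \<phi> (a, b) a a \<and> at_periphery L \<phi> (a, b) (b - 1) b)"


section \<open>Instances and their encoding\<close>

definition mlcm_instances :: "(nat \<times> line set) set" where
  "mlcm_instances = {(n, L). 2 \<le> n \<and> finite L \<and> (\<forall>l\<in>L. is_line n l)}"

text \<open>
  The number of stations, the number of lines, and the two ends of each line; the lines
  are listed without repetition, in any order.  All numbers count with their binary length.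
\<close>

definition encodes :: "nat \<times> line set \<Rightarrow> nat list \<Rightarrow> bool" where
  "encodes = (\<lambda>(n, L) w. \<exists>ls. distinct ls \<and> set ls = L \<and>
    w = n # length ls # concat (map (\<lambda>(a, b). [a, b]) ls))"

end

theory Submission
  imports Defs
begin

text \<open>
  Without crossings, two lines that share an edge keep their relative order on all common edges,
  and the periphery condition lets every line choose top or bottom at each of its two ends.  If
  \<open>l\<close> lies strictly inside \<open>l'\<close>, the two choices of \<open>l\<close> agree; if \<open>[a, b]\<close> and \<open>[c, d]\<close> satisfy
  \<open>a < c < b < d\<close>, the right choice of the first is opposite to the left choice of the second.
  These necessary conditions also suffice: the choices determine the order of any two lines that
  share an edge, and a cyclic triple must consist of lines \<open>[a, b]\<close>, \<open>[a, d]\<close>, \<open>[c, b]\<close> with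
  \<open>c < a\<close> and \<open>b < d\<close>.  Any line crossing or containing \<open>[a, b]\<close> excludes this, and if there is
  none, \<open>[a, b]\<close> is free to choose the same side at both ends.  Hence the problem is the
  satisfiability of a system of equations between literals, which is decided by merging equal
  literals and comparing each literal with its negation.
\<close>

section \<open>Reduction to equations between literals\<close>

definition crosses :: "line \<Rightarrow> line \<Rightarrow> bool" where
  "crosses l l' \<longleftrightarrow> fst l < fst l' \<and> fst l' < snd l \<and> snd l < snd l'"

definition nested :: "line \<Rightarrow> line \<Rightarrow> bool" where
  "nested l l' \<longleftrightarrow> fst l' < fst l \<and> snd l < snd l'"

text \<open>
  \<open>x l\<close> says that \<open>l\<close> is on top at its left end, and \<open>z l\<close> that it is at the bottom at its
  right end.
\<close>

definition consistent :: "line set \<Rightarrow> (line \<Rightarrow> bool) \<Rightarrow> (line \<Rightarrow> bool) \<Rightarrow> bool" where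
  "consistent L x z \<longleftrightarrow> (\<forall>l\<in>L. \<forall>l'\<in>L.
     (crosses l l' \<longrightarrow> z l = x l') \<and> (nested l l' \<longrightarrow> x l \<noteq> z l))"

section \<open>From crossing-free layouts to consistent choices\<close>

text \<open>\<open>card\<close> of an infinite set is 0, so finiteness of \<open>L\<close> is what
  lets a vanishing crossing number exclude every single crossing.\<close>

lemma crossing_number_0_iff:
  assumes "finite L"
  shows "crossing_number n L \<phi> = 0 \<longleftrightarrow>
    (\<forall>i l l'. 1 \<le> i \<and> i < n \<and> l \<in> lines_on_edge L i \<and> l' \<in> lines_on_edge L i \<and> l \<noteq> l'
       \<longrightarrow> \<not> cross_on_edge \<phi> i l l')"
proof -
  let ?S = "{({l, l'}, i) | l l' i. 1 \<le> i \<and> i < n \<and> l \<in> lines_on_edge L i \<and>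
      l' \<in> lines_on_edge L i \<and> l \<noteq> l' \<and> cross_on_edge \<phi> i l l'}"
  have "?S \<subseteq> Pow L \<times> {..<n}"
    by (auto simp: lines_on_edge_def)
  then have "finite ?S"
    using assms by (meson finite_Pow_iff finite_SigmaI finite_lessThan finite_subset)
  then have "crossing_number n L \<phi> = 0 \<longleftrightarrow> ?S = {}"
    by (simp add: crossing_number_def)
  then show ?thesis by blast
qed

lemma consistent_if_layout:
  assumes fin: "finite L" and lines: "\<forall>l\<in>L. is_line n l"
    and lay: "is_layout n L \<phi>" and adm: "admissible n L \<phi>" and per: "periphery_condition L \<phi>"
    and cr: "crossing_number n L \<phi> = 0"
  shows "\<exists>x z. consistent L x z"
proof -
  \<comment> \<open>With nobody passing through the end, \<open>x\<close> and \<open>y\<close> are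
    vacuously true; the constraints only concern ends through which another line passes.\<close>
  define x where "x l \<longleftrightarrow> (\<forall>l'\<in>lines_on_edge L (fst l).
    passes_through l' (fst l) \<longrightarrow> (l, l') \<in> \<phi> (fst l) (fst l))" for l
  define y where "y l \<longleftrightarrow> (\<forall>l'\<in>lines_on_edge L (snd l - 1).
    passes_through l' (snd l) \<longrightarrow> (l, l') \<in> \<phi> (snd l - 1) (snd l))" for l
  have edge: "(l, l') \<in> \<phi> i i \<longleftrightarrow> (l, l') \<in> \<phi> i (Suc i)"
    if "l \<in> lines_on_edge L i" "l' \<in> lines_on_edge L i" "l \<noteq> l'" for i l l'
  proof -
    have "1 \<le> i \<and> i < n"
      using that lines by (fastforce simp: lines_on_edge_def is_line_def)
    then have "\<not> cross_on_edge \<phi> i l l'"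
      using cr fin that crossing_number_0_iff by blast
    then show ?thesis by (auto simp: cross_on_edge_def)
  qed
  have station: "(l, l') \<in> \<phi> i (Suc i) \<longleftrightarrow> (l, l') \<in> \<phi> (Suc i) (Suc i)"
    if "l \<in> lines_on_edge L i" "l' \<in> lines_on_edge L i"
      "l \<in> lines_on_edge L (Suc i)" "l' \<in> lines_on_edge L (Suc i)" for i l l'
  proof -
    have "Suc i \<in> {1..n}" "l \<in> L" "l' \<in> L"
      using that lines by (fastforce simp: lines_on_edge_def is_line_def)+
    moreover have "passes_through l (Suc i)" "passes_through l' (Suc i)"
      using that by (auto simp: lines_on_edge_def passes_through_def)
    ultimately show ?thesis
      using adm unfolding admissible_def by (metis diff_Suc_1)
  qed
  \<comment> \<open>The order is carried over edges by the absence of crossings and over stations by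
    admissibility; two lines sharing edges \<open>i\<close> and \<open>j\<close> share all edges
    between.\<close>
  have same: "(l, l') \<in> \<phi> i i \<longleftrightarrow> (l, l') \<in> \<phi> j j"
    if "i \<le> j" "l \<in> lines_on_edge L i" "l' \<in> lines_on_edge L i"
      "l \<in> lines_on_edge L j" "l' \<in> lines_on_edge L j" "l \<noteq> l'" for i j l l'
    using that
  proof (induction j rule: dec_induct)
    case (step k)
    then have k: "l \<in> lines_on_edge L k" "l' \<in> lines_on_edge L k"
      by (auto simp: lines_on_edge_def)
    with step show ?case using edge station by metis
  qed simp
  have lin: "linear_order_on (lines_on_edge L i) (\<phi> i i)"
    "linear_order_on (lines_on_edge L i) (\<phi> i (Suc i))"
    if "l \<in> lines_on_edge L i" for i l
  proof -
    have "1 \<le> i \<and> i < n"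
      using that lines by (fastforce simp: lines_on_edge_def is_line_def)
    with lay show "linear_order_on (lines_on_edge L i) (\<phi> i i)"
      "linear_order_on (lines_on_edge L i) (\<phi> i (Suc i))"
      by (auto simp: is_layout_def)
  qed
  have anti: "(l, l') \<in> r \<longleftrightarrow> (l', l) \<notin> r"
    if "linear_order_on A r" "l \<in> A" "l' \<in> A" "l \<noteq> l'" for A r and l l' :: line
    using that unfolding linear_order_on_def partial_order_on_def total_on_def antisym_def by blast
  \<comment> \<open>A single passing line makes "above all" and "below all" exclusive, so any such
    line reveals the choice.\<close>
  have x_iff: "x l \<longleftrightarrow> (l, l') \<in> \<phi> (fst l) (fst l)"
    if "l \<in> L" "l' \<in> L" "fst l' < fst l" "fst l < snd l'" for l l'
  proof -
    have e: "l \<in> lines_on_edge L (fst l)" "l' \<in> lines_on_edge L (fst l)" "l \<noteq> l'"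
      using that lines by (auto simp: lines_on_edge_def is_line_def)
    have "at_periphery L \<phi> l (fst l) (fst l)"
      using per that by (auto simp: periphery_condition_def)
    moreover have "passes_through l' (fst l)"
      using that by (auto simp: passes_through_def)
    ultimately show ?thesis
      using e anti[OF lin(1)[OF e(1)] e] unfolding x_def at_periphery_def by blast
  qed
  \<comment> \<open>The order at the right end is moved to the left end of the last edge, because
    \<open>same\<close> relates left ends only.\<close>
  have y_iff: "y l \<longleftrightarrow> (l, l') \<in> \<phi> (snd l - 1) (snd l - 1)"
    if "l \<in> L" "l' \<in> L" "fst l' < snd l" "snd l < snd l'" for l l'
  proof -
    have "is_line n l" using that lines by auto
    then have e: "l \<in> lines_on_edge L (snd l - 1)" "l' \<in> lines_on_edge L (snd l - 1)" "l \<noteq> l'"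
      and S: "Suc (snd l - 1) = snd l"
      using that by (auto simp: lines_on_edge_def is_line_def)
    have "at_periphery L \<phi> l (snd l - 1) (snd l)"
      using per that by (auto simp: periphery_condition_def)
    moreover have "passes_through l' (snd l)"
      using that by (auto simp: passes_through_def)
    ultimately have "y l \<longleftrightarrow> (l, l') \<in> \<phi> (snd l - 1) (snd l)"
      using e anti[OF lin(2)[OF e(1)] e] S unfolding y_def at_periphery_def by metis
    then show ?thesis using edge[OF e] S by simp
  qed
  have "y l \<noteq> x l'" if "l \<in> L" "l' \<in> L" "crosses l l'" for l l'
  proof -
    have c: "fst l < fst l'" "fst l' < snd l" "snd l < snd l'"
      using that by (auto simp: crosses_def)
    then have e: "l \<in> lines_on_edge L (fst l')" "l' \<in> lines_on_edge L (fst l')"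
      "l \<in> lines_on_edge L (snd l - 1)" "l' \<in> lines_on_edge L (snd l - 1)" "l \<noteq> l'"
      and le: "fst l' \<le> snd l - 1"
      using that by (auto simp: lines_on_edge_def)
    have "y l \<longleftrightarrow> (l, l') \<in> \<phi> (fst l') (fst l')"
      using y_iff[of l l'] same[OF le e] that c by auto
    moreover have "x l' \<longleftrightarrow> (l', l) \<in> \<phi> (fst l') (fst l')"
      using x_iff[of l' l] that c by auto
    ultimately show ?thesis
      using anti[OF lin(1)[OF e(1)] e(1,2,5)] by blast
  qed
  moreover have "x l = y l" if "l \<in> L" "l' \<in> L" "nested l l'" for l l'
  proof -
    have c: "fst l' < fst l" "snd l < snd l'" "fst l < snd l"
      using that lines by (auto simp: nested_def is_line_def)
    then have e: "l \<in> lines_on_edge L (fst l)" "l' \<in> lines_on_edge L (fst l)"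
      "l \<in> lines_on_edge L (snd l - 1)" "l' \<in> lines_on_edge L (snd l - 1)" "l \<noteq> l'"
      and le: "fst l \<le> snd l - 1"
      using that by (auto simp: lines_on_edge_def)
    show ?thesis
      using x_iff[of l l'] y_iff[of l l'] same[OF le e] that c by auto
  qed
  ultimately have "consistent L x (\<lambda>l. \<not> y l)"
    unfolding consistent_def by blast
  then show ?thesis by blast
qed

section \<open>From consistent choices to a crossing-free layout\<close>

text \<open>One fixed comparison of lines is used at both ends of every edge, which settles
  crossings and admissibility at once. The work lies in transitivity among the lines of one
  edge.\<close>

lemma layout_if_consistent:
  assumes fin: "finite L" and lines: "\<forall>l\<in>L. is_line n l"
    and con: "consistent L x z"
  shows "\<exists>\<phi>. is_layout n L \<phi> \<and> admissible n L \<phi> \<and> periphery_condition L \<phi> \<and>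
      crossing_number n L \<phi> = 0"
proof -
  \<comment> \<open>A line that is neither contained in nor crossing another one is not subject to any constraint;
    giving it the same side at both ends is what makes the order below transitive.\<close>
  define bound where "bound l \<longleftrightarrow> (\<exists>l'\<in>L. crosses l l' \<or> crosses l' l \<or> nested l l')" for l
  define y where "y l = (if bound l then \<not> z l else x l)" for l
  have cross: "y l \<noteq> x l'" if "l \<in> L" "l' \<in> L" "crosses l l'" for l l'
    using con that by (auto simp: consistent_def y_def bound_def)
  have nest: "y l = x l" if "l \<in> L" "l' \<in> L" "nested l l'" for l l'
    using con that by (auto simp: consistent_def y_def bound_def)
  \<comment> \<open>In the triple \<open>l\<close>, \<open>l'\<close>, \<open>l''\<close> the order
    of \<open>l\<close> and \<open>l'\<close> is decided by \<open>y l\<close>, that of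
    \<open>l\<close> and \<open>l''\<close> by \<open>x l\<close>, that of \<open>l'\<close> and
    \<open>l''\<close> by \<open>x l'\<close>; the two inequalities say precisely that this is a
    cycle.\<close>
  have key: "\<not> (y l \<noteq> x l \<and> x l' \<noteq> x l)"
    if L: "l \<in> L" "l' \<in> L" "l'' \<in> L" and h: "fst l' = fst l" "snd l < snd l'"
      "snd l'' = snd l" "fst l'' < fst l" for l l' l''
  proof
    assume neq: "y l \<noteq> x l \<and> x l' \<noteq> x l"
    then have "bound l" by (metis y_def)
    then obtain m where m: "m \<in> L" "crosses l m \<or> crosses m l \<or> nested l m"
      by (auto simp: bound_def)
    have "fst l < snd l" using lines L by (auto simp: is_line_def)
    \<comment> \<open>In the first case \<open>y l = y l''\<close> via \<open>m\<close>, and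
      \<open>y l''\<close> differs from \<open>x l'\<close>; in the second \<open>x l = x l'\<close>
      via \<open>m\<close>; in the third \<open>y l = x l\<close>. Each refutes the cycle.\<close>
    then consider "crosses l m" "crosses l'' m" "crosses l'' l'"
      | "crosses m l" "crosses m l'" | "nested l m"
      using m h by (auto simp: crosses_def)
    then show False
      using neq cross nest m L by cases metis+
  qed
  \<comment> \<open>Two lines are compared where the later one starts, or, for a common start, where
    the earlier one ends.\<close>
  define ab where "ab l l' = (if fst l' < fst l then x l else if fst l < fst l' then \<not> x l'
    else if snd l < snd l' then y l else \<not> y l')" for l l'
  have ab_anti: "ab l l' \<longleftrightarrow> \<not> ab l' l" if "l \<noteq> l'" for l l'
    using that by (auto simp: ab_def prod_eq_iff)
  have ab_trans: "ab p r"
    if "p \<in> lines_on_edge L i" "q \<in> lines_on_edge L i" "r \<in> lines_on_edge L i"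
      "p \<noteq> q" "q \<noteq> r" "p \<noteq> r" "ab p q" "ab q r" for p q r i
  proof (rule ccontr)
    assume "\<not> ab p r"
    then have rp: "ab r p" using ab_anti that by blast
    have e: "p \<in> L" "q \<in> L" "r \<in> L" "fst p \<le> i" "i < snd p" "fst q \<le> i" "i < snd q"
      "fst r \<le> i" "i < snd r"
      using that by (auto simp: lines_on_edge_def)
    note k = key[OF e(1-3)] key[OF e(1,3,2)] key[OF e(2,1,3)] key[OF e(2,3,1)]
      key[OF e(3,1,2)] key[OF e(3,2,1)]
    have ne: "fst p \<noteq> fst q \<or> snd p \<noteq> snd q" "fst p \<noteq> fst r \<or> snd p \<noteq> snd r"
      "fst q \<noteq> fst r \<or> snd q \<noteq> snd r"
      using that by (auto simp: prod_eq_iff)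
    have left: "ab s t = x s" if "fst t < fst s" for s t
      using that by (simp add: ab_def)
    \<comment> \<open>For lines sharing an edge, the right choice of the line ending first gives the
      same verdict as \<open>ab\<close>: this is where the constraints enter.\<close>
    have right: "ab s t = y s" if st: "s \<in> {p, q, r}" "t \<in> {p, q, r}" "snd s < snd t" for s t
    proof -
      have "fst t < snd s" using st e by auto
      then consider "nested s t" | "crosses s t" | "fst s = fst t"
        using st(3) unfolding nested_def crosses_def by (metis nat_neq_iff)
      then show ?thesis
        using nest[of s t] cross[of s t] st e
        by cases (auto simp: ab_def nested_def crosses_def)
    qed
    have f: "\<not> ab q p" "\<not> ab r q" "\<not> ab p r"
      using that rp ab_anti by blast+
    have tie: "(u = v \<and> w < u) \<or> (u = w \<and> v < u) \<or> (v = w \<and> u < v) \<or> (u = v \<and> v = w)"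
      if "\<not> (v < u \<and> w < u)" "\<not> (u < v \<and> w < v)" "\<not> (u < w \<and> v < w)" for u v w :: int
      using that by linarith
    \<comment> \<open>A line with the strictly largest left end would be above both others or below
      both, impossible in a cycle. So the largest left end is attained twice, and likewise the
      smallest right end.\<close>
    have "\<not> (fst q < fst p \<and> fst r < fst p)" "\<not> (fst p < fst q \<and> fst r < fst q)"
      "\<not> (fst p < fst r \<and> fst q < fst r)"
      using left rp that(7,8) f by blast+
    then have 1: "(fst p = fst q \<and> fst r < fst p) \<or> (fst p = fst r \<and> fst q < fst p) \<or>
        (fst q = fst r \<and> fst p < fst q) \<or> (fst p = fst q \<and> fst q = fst r \<and> fst p = fst r)"
      using tie[of "int (fst q)" "int (fst p)" "int (fst r)"] by auto
    have "\<not> (snd p < snd q \<and> snd p < snd r)" "\<not> (snd q < snd p \<and> snd q < snd r)"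
      "\<not> (snd r < snd p \<and> snd r < snd q)"
      using right rp that(7,8) f by blast+
    then have 2: "(snd p = snd q \<and> snd p < snd r) \<or> (snd p = snd r \<and> snd p < snd q) \<or>
        (snd q = snd r \<and> snd q < snd p) \<or> (snd p = snd q \<and> snd q = snd r \<and> snd p = snd r)"
      using tie[of "- int (snd q)" "- int (snd p)" "- int (snd r)"] by auto
    \<comment> \<open>As the lines are distinct, one of them has both the largest left end and the
      smallest right end and shares each with a different partner: the triple of \<open>key\<close>,
      in six arrangements.\<close>
    have "(fst p = fst q \<and> fst r < fst p \<and> snd p = snd r \<and> snd p < snd q) \<or>
        (fst p = fst r \<and> fst q < fst p \<and> snd p = snd q \<and> snd p < snd r) \<or>
        (fst p = fst q \<and> fst r < fst p \<and> snd q = snd r \<and> snd q < snd p) \<or>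
        (fst q = fst r \<and> fst p < fst q \<and> snd p = snd q \<and> snd p < snd r) \<or>
        (fst p = fst r \<and> fst q < fst p \<and> snd q = snd r \<and> snd q < snd p) \<or>
        (fst q = fst r \<and> fst p < fst q \<and> snd p = snd r \<and> snd p < snd q)"
      using 1 2 ne by blast
    then show False
      using rp that(7,8) f k left right by (elim disjE) (metis insertCI)+
  qed
  define \<phi> :: layout where "\<phi> i s = {(l, l'). l \<in> lines_on_edge L i \<and> l' \<in> lines_on_edge L i \<and>
    (l = l' \<or> ab l l')}" for i s
  have "linear_order_on (lines_on_edge L i) (\<phi> i s)" for i s
    unfolding linear_order_on_def partial_order_on_def preorder_on_def
  proof (intro conjI)
    show "refl_on (lines_on_edge L i) (\<phi> i s)"
      by (auto simp: refl_on_def \<phi>_def)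
    show "\<phi> i s \<subseteq> lines_on_edge L i \<times> lines_on_edge L i"
      by (auto simp: \<phi>_def)
    show "trans (\<phi> i s)"
    proof (rule transI)
      fix p q r assume "(p, q) \<in> \<phi> i s" "(q, r) \<in> \<phi> i s"
      then show "(p, r) \<in> \<phi> i s"
        using ab_trans[of p i q r] unfolding \<phi>_def mem_Collect_eq prod.case by metis
    qed
    show "antisym (\<phi> i s)"
      unfolding antisym_def \<phi>_def using ab_anti by blast
    show "total_on (lines_on_edge L i) (\<phi> i s)"
      unfolding total_on_def \<phi>_def using ab_anti by blast
  qed
  then have lay: "is_layout n L \<phi>"
    by (simp add: is_layout_def)
  have adm: "admissible n L \<phi>"
    by (auto simp: admissible_def \<phi>_def passes_through_def lines_on_edge_def)
  have cr: "crossing_number n L \<phi> = 0"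
    using fin by (auto simp: crossing_number_0_iff cross_on_edge_def \<phi>_def)
  have outer: "at_periphery L \<phi> l i s"
    if "l \<in> lines_on_edge L i"
      and eq: "\<And>l'. l' \<in> L \<Longrightarrow> passes_through l' s \<Longrightarrow> l \<noteq> l' \<and> ab l l' = v" for l i s v
  proof -
    have "(l, l') \<in> \<phi> i s" if "v" "l' \<in> lines_on_edge L i" "passes_through l' s" for l'
      using \<open>l \<in> lines_on_edge L i\<close> eq[of l'] that by (auto simp: \<phi>_def lines_on_edge_def)
    moreover have "(l', l) \<in> \<phi> i s" if "\<not> v" "l' \<in> lines_on_edge L i" "passes_through l' s" for l'
      using \<open>l \<in> lines_on_edge L i\<close> eq[of l'] that ab_anti[of l' l]
      by (auto simp: \<phi>_def lines_on_edge_def)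
    ultimately show ?thesis unfolding at_periphery_def by blast
  qed
  have "periphery_condition L \<phi>"
    unfolding periphery_condition_def
  proof clarify
    fix a b assume l: "(a, b) \<in> L"
    then have "a < b" using lines by (auto simp: is_line_def)
    have "ab (a, b) l' = x (a, b)" if "l' \<in> L" "passes_through l' a" for l'
      using that by (auto simp: ab_def passes_through_def)
    moreover have "ab (a, b) l' = y (a, b)" if l': "l' \<in> L" "passes_through l' b" for l'
    proof -
      \<comment> \<open>\<open>ab\<close> may decide this pair at a left end; the constraints
        translate the verdict into \<open>y (a, b)\<close>.\<close>
      consider "nested (a, b) l'" "fst l' < a" | "crosses (a, b) l'" | "fst l' = a" "b < snd l'"
        using l' linorder_less_linear[of "fst l'" a]
        by (auto simp: passes_through_def nested_def crosses_def)
      then show ?thesis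
        using nest[OF l l'(1)] cross[OF l l'(1)]
        by cases (auto simp: ab_def crosses_def)
    qed
    moreover have "(a, b) \<noteq> l'" if "passes_through l' a \<or> passes_through l' b" for l'
      using that by (auto simp: passes_through_def)
    moreover have "(a, b) \<in> lines_on_edge L a" "(a, b) \<in> lines_on_edge L (b - 1)"
      using l \<open>a < b\<close> by (auto simp: lines_on_edge_def)
    ultimately show "at_periphery L \<phi> (a, b) a a \<and> at_periphery L \<phi> (a, b) (b - 1) b"
      by (intro conjI outer) blast+
  qed
  with lay adm cr show ?thesis by blast
qed

section \<open>Steps and costs\<close>

text \<open>Runs count steps and never execute a \<open>Halt\<close>, so that they can be
  concatenated; the final \<open>Halt\<close> is charged separately.\<close>

inductive runs :: "instr list \<Rightarrow> nat \<Rightarrow> config \<Rightarrow> config \<Rightarrow> bool" for P where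
  runs_0: "runs P 0 c c"
| runs_Suc: "fst c < length P \<Longrightarrow> \<forall>b. P ! fst c \<noteq> Halt b \<Longrightarrow>
    runs P t (step (P ! fst c) c) c' \<Longrightarrow> runs P (Suc t) c c'"

lemma runs_trans: "runs P t c c' \<Longrightarrow> runs P t' c' c'' \<Longrightarrow> runs P (t + t') c c''"
  by (induction rule: runs.induct) (auto intro: runs.intros)

lemma runs_1:
  "fst c < length P \<Longrightarrow> \<forall>b. P ! fst c \<noteq> Halt b \<Longrightarrow> step (P ! fst c) c = c' \<Longrightarrow> runs P 1 c c'"
  by (simp add: runs_Suc runs_0)

text \<open>Jump targets are omitted, since the cost model does not charge for them.\<close>

fun operands :: "instr \<Rightarrow> nat list" where
  "operands (Const r c) = [r, c]"
| "operands (Copy r s) = [r, s]"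
| "operands (Add r s t) = [r, s, t]"
| "operands (Sub r s t) = [r, s, t]"
| "operands (Load r s) = [r, s]"
| "operands (Store r s) = [r, s]"
| "operands (Read r) = [r]"
| "operands (Jump k) = []"
| "operands (JumpZero r k) = [r]"
| "operands (Halt b) = []"

text \<open>
  A single step adds at most one bit to the longest register, so a bound on the number of steps
  already bounds the logarithmic cost.
\<close>

definition fits :: "nat \<Rightarrow> config \<Rightarrow> bool" where
  "fits k c \<longleftrightarrow> (\<forall>r. bit_size (fst (snd c) r) \<le> k) \<and> (\<forall>x\<in>set (snd (snd c)). bit_size x \<le> k)"

lemma bit_size_le_iff: "0 < k \<Longrightarrow> bit_size x \<le> k \<longleftrightarrow> x < 2 ^ k"
  by (simp add: bit_size_def floorlog_le_iff)

lemma bit_size_pos: "0 < bit_size x"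
  by (simp add: bit_size_def)

lemma bit_size_0: "bit_size 0 = 1"
  by (simp add: bit_size_def floorlog_def)

lemma bit_size_mono: "x \<le> y \<Longrightarrow> bit_size x \<le> bit_size y"
  by (auto simp: bit_size_def intro: floorlog_mono le_trans)

lemma bit_size_add: "bit_size x \<le> k \<Longrightarrow> bit_size y \<le> k \<Longrightarrow> bit_size (x + y) \<le> Suc k"
  using bit_size_pos[of x] bit_size_le_iff[of k] bit_size_le_iff[of "Suc k"] by fastforce

lemma bit_size_next_input:
  "\<forall>x\<in>set w. bit_size x \<le> k \<Longrightarrow> 0 < k \<Longrightarrow> bit_size (next_input w) \<le> k"
  by (auto simp: next_input_def bit_size_0 Suc_le_eq split: list.split)

text \<open>The largest charge, that of \<open>Add\<close> and \<open>Sub\<close>, consists of five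
  lengths.\<close>

lemma step_cost_le:
  assumes "fits k c" "\<forall>x\<in>set (operands i). bit_size x \<le> k"
  shows "step_cost i c \<le> 5 * k"
proof -
  obtain pc R w where c: "c = (pc, R, w)" by (cases c)
  have R: "bit_size (R r) \<le> k" for r
    using assms by (auto simp: fits_def c)
  have w: "\<forall>x\<in>set w. bit_size x \<le> k"
    using assms by (auto simp: fits_def c)
  have "0 < k" using R[of 0] bit_size_pos[of "R 0"] by linarith
  have sums: "a \<le> k \<Longrightarrow> b \<le> k \<Longrightarrow> a + b \<le> 5 * k"
    "a \<le> k \<Longrightarrow> b \<le> k \<Longrightarrow> d \<le> k \<Longrightarrow> a + b + d \<le> 5 * k"
    "a \<le> k \<Longrightarrow> b \<le> k \<Longrightarrow> d \<le> k \<Longrightarrow> e \<le> k \<Longrightarrow> a + b + d + e \<le> 5 * k"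
    "a \<le> k \<Longrightarrow> b \<le> k \<Longrightarrow> d \<le> k \<Longrightarrow> e \<le> k \<Longrightarrow> f \<le> k \<Longrightarrow> a + b + d + e + f \<le> 5 * k"
    for a b d e f by auto
  show ?thesis
    using assms(2) R bit_size_next_input[OF w \<open>0 < k\<close>] \<open>0 < k\<close>
    by (cases i) (auto simp: c intro: sums)
qed

lemma fits_step:
  assumes "fits k c" "\<forall>x\<in>set (operands i). bit_size x \<le> k"
  shows "fits (Suc k) (step i c)"
proof -
  obtain pc R w where c: "c = (pc, R, w)" by (cases c)
  have R: "bit_size (R r) \<le> k" for r
    using assms by (auto simp: fits_def c)
  have w: "\<forall>x\<in>set w. bit_size x \<le> k"
    using assms by (auto simp: fits_def c)
  have "0 < k" using R[of 0] bit_size_pos[of "R 0"] by linarith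
  have R': "bit_size (R r) \<le> Suc k" for r using R[of r] by simp
  have "\<forall>x\<in>set w. bit_size x \<le> Suc k" "\<forall>x\<in>set (tl w). bit_size x \<le> Suc k"
    using w by (auto dest: list.set_sel(2)[rotated] intro: le_SucI) (metis le_SucI list.sel(2) list.set_sel(2))
  moreover have "bit_size (R r - R s) \<le> Suc k" for r s
    using bit_size_mono[of "R r - R s" "R r"] R'[of r] by (meson diff_le_self le_trans)
  ultimately show ?thesis
    using assms(2) R' bit_size_add[OF R R] le_SucI[OF bit_size_next_input[OF w \<open>0 < k\<close>]]
    by (cases i) (auto simp: c fits_def intro: le_SucI)
qed

text \<open>Each of the \<open>Suc t\<close> instructions, the final \<open>Halt\<close> included,
  acts on numbers of at most \<open>k + t\<close> bits.\<close>

lemma halts_with_if_runs: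
  assumes "runs P t c c'" "fst c' < length P" "P ! fst c' = Halt b"
    "fits k c" "\<forall>i\<in>set P. \<forall>x\<in>set (operands i). bit_size x \<le> k"
  shows "\<exists>s. halts_with P c s b \<and> s \<le> 5 * Suc t * (k + t)"
  using assms
proof (induction arbitrary: k rule: runs.induct)
  case (runs_0 c)
  then have "\<forall>x\<in>set (operands (P ! fst c)). bit_size x \<le> k" by auto
  from step_cost_le[OF runs_0(3) this] show ?case
    using halt[OF runs_0(1,2)] by auto
next
  case (runs_Suc c t c')
  have *: "\<forall>x\<in>set (operands (P ! fst c)). bit_size x \<le> k"
    using runs_Suc.prems(4) runs_Suc.hyps(1) nth_mem by blast
  have "\<forall>i\<in>set P. \<forall>x\<in>set (operands i). bit_size x \<le> Suc k"
    using runs_Suc.prems(4) by (meson le_SucI)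
  \<comment> \<open>The width grows by one while the number of remaining steps drops by one, so
    their sum is preserved.\<close>
  from runs_Suc.IH[OF runs_Suc.prems(1,2) fits_step[OF runs_Suc.prems(3) *] this]
  obtain s where s: "halts_with P (step (P ! fst c) c) s b" "s \<le> 5 * Suc t * (Suc k + t)" by auto
  have "step_cost (P ! fst c) c + s \<le> 5 * k + 5 * Suc t * (Suc k + t)"
    using step_cost_le[OF runs_Suc.prems(3) *] s(2) by linarith
  also have "\<dots> \<le> 5 * Suc (Suc t) * (k + Suc t)"
    by (simp add: algebra_simps)
  finally show ?case
    using halts_with.run[OF runs_Suc.hyps(1,2) s(1)] by blast
qed

lemma operands_bounded: "\<exists>k. \<forall>i\<in>set P. \<forall>x\<in>set (operands i). bit_size x \<le> k"
proof -
  have "finite (\<Union>i\<in>set P. bit_size ` set (operands i))" by simp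
  then show ?thesis
    by (metis (no_types, lifting) UN_I finite_nat_set_iff_bounded_le image_eqI)
qed

section \<open>Structured programs\<close>

type_synonym state = "(nat \<Rightarrow> nat) \<times> nat list"

datatype com =
    Block "instr list"
  | Seq com com  (infixr \<open>;;\<close> 60)
  | Cond nat com com
  | While nat com

fun code_size :: "com \<Rightarrow> nat" where
  "code_size (Block is) = length is"
| "code_size (c ;; d) = code_size c + code_size d"
| "code_size (Cond r c d) = code_size c + code_size d + 2"
| "code_size (While r c) = code_size c + 2"

text \<open>The first argument is the address at which the code is placed.\<close>

fun compile :: "nat \<Rightarrow> com \<Rightarrow> instr list" where
  "compile p (Block is) = is"
| "compile p (c ;; d) = compile p c @ compile (p + code_size c) d"
| "compile p (Cond r c d) = JumpZero r (p + code_size c + 2) # compile (p + 1) c @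
     Jump (p + code_size c + code_size d + 2) # compile (p + code_size c + 2) d"
| "compile p (While r c) = JumpZero r (p + code_size c + 2) # compile (p + 1) c @ [Jump p]"

lemma length_compile [simp]: "length (compile p c) = code_size c"
  by (induction c arbitrary: p) auto

fun straight :: "instr \<Rightarrow> bool" where
  "straight (Jump k) = False"
| "straight (JumpZero r k) = False"
| "straight (Halt b) = False"
| "straight _ = True"

definition exec :: "instr \<Rightarrow> state \<Rightarrow> state" where
  "exec i s = snd (step i (0, s))"

lemma exec_simps [simp]:
  "exec (Const r c) (R, w) = (R(r := c), w)"
  "exec (Copy r s) (R, w) = (R(r := R s), w)"
  "exec (Add r s t) (R, w) = (R(r := R s + R t), w)"
  "exec (Sub r s t) (R, w) = (R(r := R s - R t), w)"
  "exec (Load r s) (R, w) = (R(r := R (R s)), w)"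
  "exec (Store r s) (R, w) = (R(R r := R s), w)"
  "exec (Read r) (R, w) = (R(r := next_input w), tl w)"
  by (simp_all add: exec_def)

lemma step_straight: "straight i \<Longrightarrow> step i (pc, s) = (Suc pc, exec i s)"
  by (cases i; cases s) (simp_all add: exec_def)

text \<open>Weakest precondition for total correctness within at most \<open>T\<close> steps, at every address.\<close>

definition wp :: "com \<Rightarrow> nat \<Rightarrow> (state \<Rightarrow> bool) \<Rightarrow> state \<Rightarrow> bool" where
  "wp c T Q s \<longleftrightarrow> (\<forall>pre post. \<exists>t s'. t \<le> T \<and> Q s' \<and>
     runs (pre @ compile (length pre) c @ post) t (length pre, s) (length pre + code_size c, s'))"

lemma wp_mono: "wp c T Q s \<Longrightarrow> T \<le> T' \<Longrightarrow> (\<And>s. Q s \<Longrightarrow> Q' s) \<Longrightarrow> wp c T' Q' s"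
  unfolding wp_def by (meson le_trans)

lemma wp_Block:
  assumes "list_all straight is" "Q (fold exec is s)" "length is \<le> T"
  shows "wp (Block is) T Q s"
proof -
  have "runs (pre @ is @ post) (length is) (length pre, s) (length pre + length is, fold exec is s)"
    for pre post
    using assms(1)
  proof (induction "is" arbitrary: pre s)
    case Nil then show ?case by (simp add: runs_0)
  next
    case (Cons i "is")
    have "runs (pre @ (i # is) @ post) (length is) (length pre + 1, exec i s)
        (length pre + length (i # is), fold exec (i # is) s)"
      using Cons.IH[of "pre @ [i]" "exec i s"] Cons.prems by simp
    moreover have "\<forall>b. i \<noteq> Halt b" using Cons.prems by auto
    ultimately show ?case
      using Cons.prems by (auto simp: step_straight intro!: runs_Suc)
  qed
  then show ?thesis
    using assms(2,3) unfolding wp_def compile.simps code_size.simps by blast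
qed

lemma wp_Seq:
  assumes "wp c T (wp d T' Q) s"
  shows "wp (c ;; d) (T + T') Q s"
  unfolding wp_def
proof (intro allI)
  fix pre post
  let ?P = "pre @ compile (length pre) (c ;; d) @ post"
  obtain t u where t: "t \<le> T" "wp d T' Q u"
    "runs ?P t (length pre, s) (length pre + code_size c, u)"
    using assms unfolding wp_def[of c]
    by (metis append_assoc compile.simps(2))
  \<comment> \<open>The code of \<open>c\<close> becomes part of the prefix of \<open>d\<close>;
    this is why \<open>wp\<close> quantifies over the surrounding code.\<close>
  obtain t' v where t': "t' \<le> T'" "Q v"
    "runs ?P t' (length pre + code_size c, u) (length pre + code_size c + code_size d, v)"
    using t(2)[unfolded wp_def, rule_format, of "pre @ compile (length pre) c" post] by auto
  show "\<exists>t s'. t \<le> T + T' \<and> Q s' \<and> runs ?P t (length pre, s) (length pre + code_size (c ;; d), s')"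
    using runs_trans[OF t(3) t'(3)] t t' by (intro exI[of _ "t + t'"] exI[of _ v]) (simp add: add.assoc)
qed

lemma wp_Cond:
  assumes "fst s r \<noteq> 0 \<Longrightarrow> wp c T Q s" "fst s r = 0 \<Longrightarrow> wp d T Q s"
  shows "wp (Cond r c d) (T + 2) Q s"
  unfolding wp_def
proof (intro allI)
  fix pre post
  let ?P = "pre @ compile (length pre) (Cond r c d) @ post"
  let ?goal = "\<exists>t s'. t \<le> T + 2 \<and> Q s' \<and> runs ?P t (length pre, s) (length pre + code_size (Cond r c d), s')"
  show ?goal
  proof (cases "fst s r = 0")
    case True
    let ?pre = "pre @ JumpZero r (length pre + code_size c + 2) # compile (length pre + 1) c @
      [Jump (length pre + code_size c + code_size d + 2)]"
    obtain t u where t: "t \<le> T" "Q u"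
      "runs ?P t (length pre + code_size c + 2, s) (length pre + code_size c + 2 + code_size d, u)"
      using assms(2)[OF True, unfolded wp_def, rule_format, of ?pre post] by (auto simp: add_ac)
    have "runs ?P 1 (length pre, s) (length pre + code_size c + 2, s)"
      using True by (intro runs_1) (cases s, auto)+
    from runs_trans[OF this t(3)] show ?thesis
      using t by (intro exI[of _ "1 + t"] exI[of _ u]) (simp add: add_ac)
  next
    case False
    let ?pre = "pre @ [JumpZero r (length pre + code_size c + 2)]"
    obtain t u where t: "t \<le> T" "Q u"
      "runs ?P t (length pre + 1, s) (length pre + 1 + code_size c, u)"
      using assms(1)[OF False, unfolded wp_def, rule_format, of ?pre
        "Jump (length pre + code_size c + code_size d + 2) # compile (length pre + code_size c + 2) d @ post"]
      by auto
    have 1: "runs ?P 1 (length pre, s) (length pre + 1, s)"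
      using False by (intro runs_1) (cases s, auto)+
    have "?P ! (length pre + 1 + code_size c) = Jump (length pre + code_size c + code_size d + 2)"
      by (simp add: nth_append)
    then have 2: "runs ?P 1 (length pre + 1 + code_size c, u) (length pre + code_size (Cond r c d), u)"
      by (intro runs_1) (cases u, simp add: add_ac)+
    show ?thesis
      using runs_trans[OF runs_trans[OF 1 t(3)] 2] t by fastforce
  qed
qed

text \<open>The number \<open>N\<close> of iterations is known in advance, so the invariant is
  indexed by the iteration and also yields termination. Each round adds the test and the jump back,
  and one last test leaves the loop.\<close>

lemma wp_While:
  assumes body: "\<And>i s. i < N \<Longrightarrow> J i s \<Longrightarrow> fst s r \<noteq> 0 \<and> wp c T (J (Suc i)) s"
    and exit: "\<And>s. J N s \<Longrightarrow> fst s r = 0 \<and> Q s"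
    and init: "J 0 s"
  shows "wp (While r c) (N * (T + 2) + 1) Q s"
  unfolding wp_def
proof (intro allI)
  fix pre post
  let ?P = "pre @ compile (length pre) (While r c) @ post"
  have P: "?P ! (length pre + 1 + code_size c) = Jump (length pre)"
    by (simp add: nth_append)
  have iter: "\<exists>t u. t \<le> T + 2 \<and> J (Suc i) u \<and> runs ?P t (length pre, s) (length pre, u)"
    if i: "i < N" "J i s" for i s
  proof -
    have nz: "fst s r \<noteq> 0" and w: "wp c T (J (Suc i)) s" using body[OF i] by auto
    let ?pre = "pre @ [JumpZero r (length pre + code_size c + 2)]"
    obtain t u where t: "t \<le> T" "J (Suc i) u"
      "runs ?P t (length pre + 1, s) (length pre + 1 + code_size c, u)"
      using w[unfolded wp_def, rule_format, of ?pre "Jump (length pre) # post"] by auto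
    have 1: "runs ?P 1 (length pre, s) (length pre + 1, s)"
      using nz by (intro runs_1) (cases s, auto)+
    have 2: "runs ?P 1 (length pre + 1 + code_size c, u) (length pre, u)"
      using P by (intro runs_1) (cases u, simp)+
    show ?thesis
      using runs_trans[OF runs_trans[OF 1 t(3)] 2] t by fastforce
  qed
  have "\<exists>t u. t \<le> i * (T + 2) \<and> J i u \<and> runs ?P t (length pre, s) (length pre, u)" if "i \<le> N" for i
    using that
  proof (induction i)
    case 0 then show ?case using init runs_0[of ?P "(length pre, s)"] by blast
  next
    case (Suc i)
    then obtain t u where t: "t \<le> i * (T + 2)" "J i u" "runs ?P t (length pre, s) (length pre, u)"
      by auto
    obtain t' v where t': "t' \<le> T + 2" "J (Suc i) v" "runs ?P t' (length pre, u) (length pre, v)"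
      using iter[of i u] t Suc.prems by auto
    have "t + t' \<le> Suc i * (T + 2)" using t t' by simp
    then show ?case using runs_trans[OF t(3) t'(3)] t' by blast
  qed
  from this[of N] obtain t u where t: "t \<le> N * (T + 2)" "J N u"
    "runs ?P t (length pre, s) (length pre, u)" by auto
  have "runs ?P 1 (length pre, u) (length pre + code_size (While r c), u)"
    using exit[OF t(2)] by (intro runs_1) (cases u, auto)+
  from runs_trans[OF t(3) this] show "\<exists>t s'. t \<le> N * (T + 2) + 1 \<and> Q s' \<and>
      runs ?P t (length pre, s) (length pre + code_size (While r c), s')"
    using t exit[OF t(2)] by (intro exI[of _ "t + 1"] exI[of _ u]) auto
qed

lemma wp_Block_Seq:
  assumes "list_all straight is" "wp d T Q (fold exec is s)" "length is + T \<le> T'"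
  shows "wp (Block is ;; d) T' Q s"
  using wp_mono[OF wp_Seq[OF wp_Block[where T = "length is"]]] assms by blast

text \<open>The result of a decision procedure is left in register \<open>0\<close>.\<close>

definition decider :: "com \<Rightarrow> instr list" where
  "decider c = compile 0 c @ [JumpZero 0 (code_size c + 2), Halt True, Halt False]"

text \<open>A polynomial bound on steps suffices: every input number has at most
  \<open>input_size w\<close> bits, and the operands in the fixed code are bounded by a
  constant.\<close>

lemma poly_time_decidable_if_wp:
  fixes T :: "nat poly"
  assumes "\<And>x w. x \<in> I \<Longrightarrow> enc x w \<Longrightarrow>
    wp c (poly T (input_size w)) (\<lambda>s. fst s 0 \<noteq> 0 \<longleftrightarrow> Q x) (\<lambda>_. 0, w)"
  shows "poly_time_decidable I enc Q"
proof -
  let ?P = "decider c"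
  obtain k where k: "\<forall>i\<in>set ?P. \<forall>x\<in>set (operands i). bit_size x \<le> k"
    using operands_bounded by blast
  let ?T = "T + 1"
  \<comment> \<open>The bound of \<open>halts_with_if_runs\<close> for \<open>T + 1\<close> steps,
    the extra one being the final test. \<open>Suc k\<close> is positive because even the number 0
    has one digit.\<close>
  let ?p = "5 * (?T + 1) * ([:Suc k, 1:] + ?T)"
  have "\<exists>t. halts_with ?P (0, (\<lambda>_. 0), w) t (Q x) \<and> t \<le> poly ?p (input_size w)"
    if x: "x \<in> I" "enc x w" for x w
  proof -
    let ?n = "input_size w"
    obtain t s where t: "t \<le> poly T ?n" "fst s 0 \<noteq> 0 \<longleftrightarrow> Q x"
      "runs ?P t (0, \<lambda>_. 0, w) (code_size c, s)"
      using assms[OF x, unfolded wp_def, rule_format, of "[]" "drop (code_size c) ?P"]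
      by (auto simp: decider_def)
    let ?pc = "if Q x then code_size c + 1 else code_size c + 2"
    have "runs ?P 1 (code_size c, s) (?pc, s)"
      using t(2) by (intro runs_1) (cases s, auto simp: decider_def nth_append)+
    from runs_trans[OF t(3) this] have r: "runs ?P (t + 1) (0, \<lambda>_. 0, w) (?pc, s)" .
    have "bit_size y \<le> ?n" if "y \<in> set w" for y
      using that by (auto simp: input_size_def intro: member_le_sum_list)
    then have "fits (Suc k + ?n) (0, \<lambda>_. 0, w)"
      by (auto simp: fits_def bit_size_0 le_SucI trans_le_add2)
    moreover have "\<forall>i\<in>set ?P. \<forall>x\<in>set (operands i). bit_size x \<le> Suc k + ?n"
      using k by (metis le_SucI trans_le_add1 add_Suc)
    moreover have "?pc < length ?P" "?P ! ?pc = Halt (Q x)"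
      by (auto simp: decider_def nth_append)
    ultimately obtain s where s: "halts_with ?P (0, \<lambda>_. 0, w) s (Q x)"
      "s \<le> 5 * Suc (t + 1) * (Suc k + ?n + (t + 1))"
      using halts_with_if_runs[OF r, of "Q x" "Suc k + ?n"] by auto
    note s(2)
    also have "5 * Suc (t + 1) * (Suc k + ?n + (t + 1)) \<le> poly ?p ?n"
      using t(1) unfolding poly_mult poly_add
      by (intro mult_mono) (auto simp: numeral_poly)
    finally show ?thesis using s(1) by blast
  qed
  then show ?thesis
    unfolding poly_time_decidable_def by blast
qed

section \<open>The decision procedure\<close>

abbreviation skip :: com where "skip \<equiv> Block []"

text \<open>
  Registers: \<open>1\<close> holds the constant \<open>1\<close>, \<open>2\<close> the number \<open>m\<close> of lines, \<open>3\<close> the address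
  \<open>32 + 2 * m\<close> of the label array and \<open>4\<close> its length \<open>4 * m\<close>.  The ends of the lines are stored
  from address \<open>32\<close> on.  Loop counter, line pointer and label pointer are \<open>5, 6, 7\<close> for the outer
  and \<open>8, 9, 10\<close> for the inner loop; \<open>11, \<dots>, 14\<close> are the ends of the two current lines.  The
  arguments of \<open>merge\<close> are the label addresses in \<open>18\<close> and \<open>19\<close>.
\<close>

definition merge :: com where
  "merge = Block [Load 20 18, Load 21 19, Copy 22 4, Copy 23 3] ;;
    While 22
      (Block [Load 24 23, Sub 25 24 20, Sub 26 20 24, Add 24 25 26] ;;
       Cond 24 skip (Block [Store 23 21]) ;;
       Block [Add 23 23 1, Sub 22 22 1])"

text \<open>Two labels are equal exactly if both truncated differences vanish, hence the sum in
  register 24. The labels of \<open>u\<close> and \<open>v\<close> are saved in 20 and 21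
  beforehand, as the loop overwrites the cell of \<open>u\<close>.\<close>

lemma wp_merge:
  assumes R: "R 1 = 1" "R 3 = b" "R 4 = N" "R 18 = b + u" "R 19 = b + v" and "32 \<le> b"
    and post: "\<And>R'. \<forall>r. r < 20 \<or> 32 \<le> r \<and> r < b \<longrightarrow> R' r = R r \<Longrightarrow>
      \<forall>k<N. R' (b + k) = (if R (b + k) = R (b + u) then R (b + v) else R (b + k)) \<Longrightarrow> Q (R', w)"
  shows "wp merge (11 * N + 5) Q (R, w)"
proof -
  \<comment> \<open>After \<open>i\<close> rounds the first \<open>i\<close> cells are relabelled
    with respect to the original contents \<open>R\<close>, and the rest are untouched.\<close>
  define J where "J = (\<lambda>i s. snd s = w \<and> (\<forall>r. r < 20 \<or> 32 \<le> r \<and> r < b \<longrightarrow> fst s r = R r) \<and>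
    fst s 20 = R (b + u) \<and> fst s 21 = R (b + v) \<and> fst s 22 = N - i \<and> fst s 23 = b + i \<and>
    (\<forall>k<N. fst s (b + k) =
      (if k < i \<and> R (b + k) = R (b + u) then R (b + v) else R (b + k))))"
  have init: "J 0 (fold exec [Load 20 18, Load 21 19, Copy 22 4, Copy 23 3] (R, w))"
    using R \<open>32 \<le> b\<close> by (auto simp: J_def)
  have body: "fst s 22 \<noteq> 0 \<and> wp (Block [Load 24 23, Sub 25 24 20, Sub 26 20 24, Add 24 25 26] ;;
       Cond 24 skip (Block [Store 23 21]) ;;
       Block [Add 23 23 1, Sub 22 22 1]) 9 (J (Suc i)) s" if "i < N" "J i s" for i s
  proof
    obtain R' where s: "s = (R', w)" using \<open>J i s\<close> by (cases s) (auto simp: J_def)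
    have r: "\<forall>r. r < 20 \<or> 32 \<le> r \<and> r < b \<longrightarrow> R' r = R r"
      "R' 20 = R (b + u)" "R' 21 = R (b + v)" "R' 22 = N - i" "R' 23 = b + i"
      "\<forall>k<N. R' (b + k) =
        (if k < i \<and> R (b + k) = R (b + u) then R (b + v) else R (b + k))"
      using \<open>J i s\<close> by (auto simp: J_def s)
    then show "fst s 22 \<noteq> 0" using \<open>i < N\<close> by (simp add: s)
    have "R' 1 = 1" using r(1) R by auto
    have cell: "R' (b + i) = R (b + i)" using r(6) \<open>i < N\<close> by auto
    show "wp (Block [Load 24 23, Sub 25 24 20, Sub 26 20 24, Add 24 25 26] ;;
       Cond 24 skip (Block [Store 23 21]) ;;
       Block [Add 23 23 1, Sub 22 22 1]) 9 (J (Suc i)) s"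
      unfolding s
      apply (rule wp_Block_Seq[where T = "(1 + 2) + 2"], simp)
       apply (rule wp_Seq, rule wp_Cond; rule wp_Block; (simp; fail)?; rule wp_Block; (simp; fail)?)
      using r \<open>i < N\<close> \<open>R' 1 = 1\<close> cell \<open>32 \<le> b\<close>
      by (auto simp: J_def less_Suc_eq)
  qed
  have exit: "fst s 22 = 0 \<and> Q s" if "J N s" for s
    using that post[of "fst s"] by (cases s) (auto simp: J_def)
  show ?thesis
    unfolding merge_def
    by (rule wp_Block_Seq[where T = "N * (9 + 2) + 1"], simp)
      (rule wp_While[of N J, OF body exit init], auto)
qed

text \<open>
  The literals \<open>x l\<close>, \<open>\<not> x l\<close>, \<open>z l\<close>, \<open>\<not> z l\<close> of the line \<open>l = ls ! i\<close> are numbered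
  \<open>4 * i, \<dots>, 4 * i + 3\<close>; a constraint is a pair of literals that must have the same value.
\<close>

definition constraints :: "line list \<Rightarrow> nat \<Rightarrow> nat \<Rightarrow> (nat \<times> nat) set" where
  "constraints ls i j =
    (if crosses (ls ! i) (ls ! j) then {(4 * i + 2, 4 * j), (4 * i + 3, 4 * j + 1)} else {}) \<union>
    (if nested (ls ! i) (ls ! j) then {(4 * i, 4 * i + 3), (4 * i + 1, 4 * i + 2)} else {})"

definition all_constraints :: "line list \<Rightarrow> (nat \<times> nat) set" where
  "all_constraints ls = (\<Union>i<length ls. \<Union>j<length ls. constraints ls i j)"

text \<open>
  The labels identify literals related by \<open>C\<close>, and no others than those that every solution
  identifies.
\<close>

definition labelling :: "line list \<Rightarrow> (nat \<times> nat) set \<Rightarrow> (nat \<Rightarrow> nat) \<Rightarrow> bool" where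
  "labelling ls C lab \<longleftrightarrow> (\<forall>(u, v)\<in>C. lab u = lab v) \<and>
    (\<forall>T :: nat \<Rightarrow> bool. (\<forall>(u, v)\<in>all_constraints ls. T u = T v) \<longrightarrow>
      (\<forall>u < 4 * length ls. \<forall>v < 4 * length ls. lab u = lab v \<longrightarrow> T u = T v))"

lemma all_constraints_less:
  "(u, v) \<in> all_constraints ls \<Longrightarrow> u < 4 * length ls \<and> v < 4 * length ls"
  by (auto simp: all_constraints_def constraints_def split: if_splits)

section \<open>Correctness of merging labels\<close>

text \<open>Any newly created equality of labels links the class of \<open>u\<close> to that of
  \<open>v\<close>, which every solution identifies anyway. The inclusion of \<open>C\<close> keeps
  its literals in the range where \<open>lab'\<close> is prescribed.\<close>

lemma labelling_merge:
  assumes lab: "labelling ls C lab" and uv: "(u, v) \<in> all_constraints ls"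
    and C: "C \<subseteq> all_constraints ls"
    and lab': "\<forall>k < 4 * length ls. lab' k = (if lab k = lab u then lab v else lab k)"
  shows "labelling ls (insert (u, v) C) lab'"
  unfolding labelling_def
proof (intro conjI allI impI)
  have "lab' a = lab' b" if "(a, b) \<in> C" for a b
  proof -
    have "lab a = lab b" using lab that by (auto simp: labelling_def)
    moreover have "a < 4 * length ls" "b < 4 * length ls"
      using C that all_constraints_less by blast+
    ultimately show ?thesis using lab' by simp
  qed
  moreover have "lab' u = lab' v"
    using lab' all_constraints_less[OF uv] by simp
  ultimately show "\<forall>(a, b)\<in>insert (u, v) C. lab' a = lab' b" by blast
next
  fix T :: "nat \<Rightarrow> bool" and a b
  assume T: "\<forall>(u, v)\<in>all_constraints ls. T u = T v" and ab: "a < 4 * length ls" "b < 4 * length ls"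
    and eq: "lab' a = lab' b"
  have T_eq: "T c = T d" if "c < 4 * length ls" "d < 4 * length ls" "lab c = lab d" for c d
    using lab T that unfolding labelling_def by blast
  have "T u = T v" using T uv by auto
  moreover have "(if lab a = lab u then lab v else lab a) = (if lab b = lab u then lab v else lab b)"
    using eq lab' ab by simp
  ultimately show "T a = T b"
    using T_eq ab all_constraints_less[OF uv] by metis
qed

text \<open>A solution separates each literal from its negation, hence so do the labels. Conversely,
  distinct labels yield a solution because each equation also occurs in negated form.\<close>

lemma labels_distinct_iff_consistent:
  assumes "distinct ls" and lab: "labelling ls (all_constraints ls) lab"
  shows "(\<forall>k < 2 * length ls. lab (2 * k) \<noteq> lab (2 * k + 1)) \<longleftrightarrow> (\<exists>x z. consistent (set ls) x z)"
proof
  assume ne: "\<forall>k < 2 * length ls. lab (2 * k) \<noteq> lab (2 * k + 1)"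
  define idx where "idx l = (THE i. i < length ls \<and> ls ! i = l)" for l
  have idx: "idx (ls ! i) = i" if "i < length ls" for i
    unfolding idx_def using that \<open>distinct ls\<close>
    by (intro the_equality) (simp, metis nth_eq_iff_index_eq)
  \<comment> \<open>A literal is true if its label is smaller than that of its negation.\<close>
  define x where "x l \<longleftrightarrow> lab (4 * idx l) < lab (4 * idx l + 1)" for l
  define z where "z l \<longleftrightarrow> lab (4 * idx l + 2) < lab (4 * idx l + 3)" for l
  have "(crosses l l' \<longrightarrow> z l = x l') \<and> (nested l l' \<longrightarrow> x l \<noteq> z l)"
    if ll': "l \<in> set ls" "l' \<in> set ls" for l l'
  proof -
    obtain i j where ij: "i < length ls" "j < length ls" "l = ls ! i" "l' = ls ! j"
      using ll' by (auto simp: in_set_conv_nth)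
    then have "constraints ls i j \<subseteq> all_constraints ls"
      by (auto simp: all_constraints_def)
    then have eq: "\<forall>(u, v)\<in>constraints ls i j. lab u = lab v"
      using lab by (auto simp: labelling_def)
    have "lab (4 * i) \<noteq> lab (4 * i + 1)"
      using ne[rule_format, of "2 * i"] ij by simp
    moreover have "idx l = i" "idx l' = j" using idx ij by simp_all
    \<comment> \<open>A crossing makes the two label pairs equal, so the comparisons agree; nesting
      makes them equal after a swap, so distinct labels compare in opposite ways.\<close>
    ultimately show ?thesis
      using eq unfolding constraints_def x_def z_def ij(3,4)[symmetric]
      by (auto simp del: One_nat_def)
  qed
  then show "\<exists>x z. consistent (set ls) x z"
    unfolding consistent_def by blast
next
  assume "\<exists>x z. consistent (set ls) x z"
  then obtain x z where xz: "consistent (set ls) x z" by blast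
  \<comment> \<open>The truth value of literal number \<open>k\<close>, which belongs to line
    \<open>k div 4\<close>.\<close>
  define T where "T k = (let l = ls ! (k div 4) in
    if k mod 4 = 0 then x l else if k mod 4 = 1 then \<not> x l else if k mod 4 = 2 then z l else \<not> z l)" for k
  have "(4 * i + r) div 4 = i" "(4 * i + r) mod 4 = r" if "r < 4" for i r :: nat
    using that by simp_all
  from this[of 0] this[of 1] this[of 2] this[of 3]
  have T: "T (4 * i) = x (ls ! i)" "T (4 * i + 1) = (\<not> x (ls ! i))" "T (4 * i + 2) = z (ls ! i)"
    "T (4 * i + 3) = (\<not> z (ls ! i))" for i
    unfolding T_def by simp_all
  have "\<forall>(u, v)\<in>all_constraints ls. T u = T v"
    unfolding all_constraints_def
  proof clarify
    fix u v i j assume ij: "i < length ls" "j < length ls" "(u, v) \<in> constraints ls i j"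
    then have "(crosses (ls ! i) (ls ! j) \<longrightarrow> z (ls ! i) = x (ls ! j)) \<and>
        (nested (ls ! i) (ls ! j) \<longrightarrow> x (ls ! i) \<noteq> z (ls ! i))"
      using xz unfolding consistent_def by (meson nth_mem)
    then show "T u = T v"
      using ij T[of i] T[of j] by (auto simp: constraints_def split: if_splits)
  qed
  then have *: "T a = T b" if "a < 4 * length ls" "b < 4 * length ls" "lab a = lab b" for a b
    using lab that unfolding labelling_def by blast
  show "\<forall>k < 2 * length ls. lab (2 * k) \<noteq> lab (2 * k + 1)"
  proof (intro allI impI)
    fix k assume "k < 2 * length ls"
    moreover have "T (2 * k) \<noteq> T (2 * k + 1)"
    proof (cases "even k")
      case True
      then obtain i where "k = 2 * i" by blast
      then show ?thesis using T[of i] by simp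
    next
      case False
      then obtain i where "k = 2 * i + 1" by (elim oddE)
      then have "2 * k = 4 * i + 2" "2 * k + 1 = 4 * i + 3" by simp_all
      then show ?thesis using T(3,4)[of i] by metis
    qed
    ultimately show "lab (2 * k) \<noteq> lab (2 * k + 1)"
      using *[of "2 * k" "2 * k + 1"] by auto
  qed
qed

section \<open>The memory invariant and the code for single constraints\<close>

text \<open>\<open>C\<close> is the set of constraints merged so far; the labels directly follow the
  stored ends.\<close>

definition memory :: "line list \<Rightarrow> (nat \<times> nat) set \<Rightarrow> (nat \<Rightarrow> nat) \<Rightarrow> bool" where
  "memory ls C R \<longleftrightarrow> R 1 = 1 \<and> R 2 = length ls \<and> R 3 = 32 + 2 * length ls \<and> R 4 = 4 * length ls \<and>
    (\<forall>i < length ls. R (32 + 2 * i) = fst (ls ! i) \<and> R (33 + 2 * i) = snd (ls ! i)) \<and>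
    labelling ls C (\<lambda>k. R (32 + 2 * length ls + k))"

lemma memory_cong:
  assumes "memory ls C R" "\<And>r. r \<in> {1, 2, 3, 4} \<union> {32..} \<Longrightarrow> R' r = R r"
  shows "memory ls C R'"
  using assms by (auto simp: memory_def)

text \<open>Registers below 20 survive, so loop counters and pointers stay intact, and the arguments
  in 18 and 19 can be adjusted for the next merge.\<close>

lemma wp_merge_memory:
  assumes mem: "memory ls C R" and uv: "(u, v) \<in> all_constraints ls" and C: "C \<subseteq> all_constraints ls"
    and R: "R 18 = R 3 + u" "R 19 = R 3 + v"
    and post: "\<And>R'. memory ls (insert (u, v) C) R' \<Longrightarrow> \<forall>r<20. R' r = R r \<Longrightarrow> Q (R', w)"
  shows "wp merge (44 * length ls + 5) Q (R, w)"
proof -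
  let ?b = "32 + 2 * length ls"
  have m: "R 1 = 1" "R 3 = ?b" "R 4 = 4 * length ls" "R 18 = ?b + u" "R 19 = ?b + v"
    using mem R by (auto simp: memory_def)
  have "wp merge (11 * (4 * length ls) + 5) Q (R, w)"
  proof (rule wp_merge[OF m])
    fix R' assume same: "\<forall>r. r < 20 \<or> 32 \<le> r \<and> r < ?b \<longrightarrow> R' r = R r"
      and lab: "\<forall>k < 4 * length ls. R' (?b + k) =
        (if R (?b + k) = R (?b + u) then R (?b + v) else R (?b + k))"
    have "labelling ls (insert (u, v) C) (\<lambda>k. R' (?b + k))"
      using mem lab
      by (intro labelling_merge[OF _ uv C, where lab = "\<lambda>k. R (?b + k)"]) (simp_all add: memory_def)
    then have "memory ls (insert (u, v) C) R'"
      using mem same by (auto simp: memory_def)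
    then show "Q (R', w)" using same by (intro post) auto
  qed simp
  then show ?thesis by simp
qed

text \<open>The second merge handles the negated literals, whose numbers are one larger.\<close>

definition cross_constraint :: com where
  "cross_constraint = Block [Add 18 7 1, Add 18 18 1, Copy 19 10] ;; merge ;;
     Block [Add 18 18 1, Add 19 19 1] ;; merge"

definition nest_constraint :: com where
  "nest_constraint = Block [Copy 18 7, Add 19 7 1, Add 19 19 1, Add 19 19 1] ;; merge ;;
     Block [Add 18 18 1, Sub 19 19 1] ;; merge"

lemma wp_cross_constraint:
  assumes mem: "memory ls C R" and C: "C \<subseteq> all_constraints ls"
    and R: "R 7 = R 3 + 4 * i" "R 10 = R 3 + 4 * j"
    and uv: "(4 * i + 2, 4 * j) \<in> all_constraints ls" "(4 * i + 3, 4 * j + 1) \<in> all_constraints ls"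
    and post: "\<And>R'. memory ls (C \<union> {(4 * i + 2, 4 * j), (4 * i + 3, 4 * j + 1)}) R' \<Longrightarrow>
      \<forall>r<18. R' r = R r \<Longrightarrow> Q (R', w)"
  shows "wp cross_constraint (88 * length ls + 15) Q (R, w)"
proof -
  let ?T = "44 * length ls + 5"
  let ?R = "fst (fold exec [Add 18 7 1, Add 18 18 1, Copy 19 10] (R, w))"
  have R1: "R 1 = 1" using mem by (simp add: memory_def)
  have "memory ls C ?R" by (rule memory_cong[OF mem]) auto
  moreover have "?R 18 = ?R 3 + (4 * i + 2)" "?R 19 = ?R 3 + 4 * j"
    using R R1 by simp_all
  ultimately have 1: "wp merge ?T
      (wp (Block [Add 18 18 1, Add 19 19 1] ;; merge) (2 + ?T) Q) (?R, w)"
  proof (rule wp_merge_memory[OF _ uv(1) C])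
    fix R' assume mem': "memory ls (insert (4 * i + 2, 4 * j) C) R'" and eq: "\<forall>r<20. R' r = ?R r"
    let ?R' = "fst (fold exec [Add 18 18 1, Add 19 19 1] (R', w))"
    have R': "R' 1 = 1" "R' 3 = R 3" "R' 18 = R 3 + (4 * i + 2)" "R' 19 = R 3 + 4 * j"
      using eq R R1 by simp_all
    have "memory ls (insert (4 * i + 2, 4 * j) C) ?R'" by (rule memory_cong[OF mem']) auto
    moreover have "insert (4 * i + 2, 4 * j) C \<subseteq> all_constraints ls" using C uv by blast
    moreover have "?R' 18 = ?R' 3 + (4 * i + 3)" "?R' 19 = ?R' 3 + (4 * j + 1)"
      using R' by simp_all
    ultimately have "wp merge ?T Q (?R', w)"
    proof (rule wp_merge_memory[OF _ uv(2)])
      fix R'' assume mem'': "memory ls (insert (4 * i + 3, 4 * j + 1) (insert (4 * i + 2, 4 * j) C)) R''"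
        and eq': "\<forall>r<20. R'' r = ?R' r"
      have "\<forall>r<18. R'' r = R r" using eq eq' by simp
      moreover have "memory ls (C \<union> {(4 * i + 2, 4 * j), (4 * i + 3, 4 * j + 1)}) R''"
        using mem'' by (simp add: insert_commute)
      ultimately show "Q (R'', w)" by (rule post[rotated])
    qed
    then show "wp (Block [Add 18 18 1, Add 19 19 1] ;; merge) (2 + ?T) Q (R', w)"
      by (intro wp_Block_Seq[where T = ?T]) simp_all
  qed
  show ?thesis
    unfolding cross_constraint_def
    by (rule wp_Block_Seq[where T = "?T + (2 + ?T)"], simp) (use wp_Seq[OF 1] in simp_all)
qed

lemma wp_nest_constraint:
  assumes mem: "memory ls C R" and C: "C \<subseteq> all_constraints ls"
    and R: "R 7 = R 3 + 4 * i"
    and uv: "(4 * i, 4 * i + 3) \<in> all_constraints ls" "(4 * i + 1, 4 * i + 2) \<in> all_constraints ls"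
    and post: "\<And>R'. memory ls (C \<union> {(4 * i, 4 * i + 3), (4 * i + 1, 4 * i + 2)}) R' \<Longrightarrow>
      \<forall>r<18. R' r = R r \<Longrightarrow> Q (R', w)"
  shows "wp nest_constraint (88 * length ls + 16) Q (R, w)"
proof -
  let ?T = "44 * length ls + 5"
  let ?R = "fst (fold exec [Copy 18 7, Add 19 7 1, Add 19 19 1, Add 19 19 1] (R, w))"
  have R1: "R 1 = 1" using mem by (simp add: memory_def)
  have "memory ls C ?R" by (rule memory_cong[OF mem]) auto
  moreover have "?R 18 = ?R 3 + 4 * i" "?R 19 = ?R 3 + (4 * i + 3)"
    using R R1 by simp_all
  ultimately have 1: "wp merge ?T
      (wp (Block [Add 18 18 1, Sub 19 19 1] ;; merge) (2 + ?T) Q) (?R, w)"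
  proof (rule wp_merge_memory[OF _ uv(1) C])
    fix R' assume mem': "memory ls (insert (4 * i, 4 * i + 3) C) R'" and eq: "\<forall>r<20. R' r = ?R r"
    let ?R' = "fst (fold exec [Add 18 18 1, Sub 19 19 1] (R', w))"
    have R': "R' 1 = 1" "R' 3 = R 3" "R' 18 = R 3 + 4 * i" "R' 19 = R 3 + (4 * i + 3)"
      using eq R R1 by simp_all
    have "memory ls (insert (4 * i, 4 * i + 3) C) ?R'" by (rule memory_cong[OF mem']) auto
    moreover have "insert (4 * i, 4 * i + 3) C \<subseteq> all_constraints ls" using C uv by blast
    moreover have "?R' 18 = ?R' 3 + (4 * i + 1)" "?R' 19 = ?R' 3 + (4 * i + 2)"
      using R' by simp_all
    ultimately have "wp merge ?T Q (?R', w)"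
    proof (rule wp_merge_memory[OF _ uv(2)])
      fix R'' assume mem'': "memory ls (insert (4 * i + 1, 4 * i + 2) (insert (4 * i, 4 * i + 3) C)) R''"
        and eq': "\<forall>r<20. R'' r = ?R' r"
      have "\<forall>r<18. R'' r = R r" using eq eq' by simp
      moreover have "memory ls (C \<union> {(4 * i, 4 * i + 3), (4 * i + 1, 4 * i + 2)}) R''"
        using mem'' by (simp add: insert_commute)
      ultimately show "Q (R'', w)" by (rule post[rotated])
    qed
    then show "wp (Block [Add 18 18 1, Sub 19 19 1] ;; merge) (2 + ?T) Q (R', w)"
      by (intro wp_Block_Seq[where T = ?T]) simp_all
  qed
  show ?thesis
    unfolding nest_constraint_def
    by (rule wp_Block_Seq[where T = "?T + (2 + ?T)"], simp) (use wp_Seq[OF 1] in simp_all)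
qed

section \<open>The loops of the procedure\<close>

text \<open>A truncated difference is nonzero exactly for a strict inequality, so the nested
  conditionals test \<open>crosses\<close> and then \<open>nested\<close>. Register 17 serves both
  tests, while 15 is recomputed for the reversed comparison of left ends.\<close>

definition pair_body :: com where
  "pair_body =
    Block [Load 13 9, Add 15 9 1, Load 14 15, Sub 15 13 11, Sub 16 12 13, Sub 17 14 12] ;;
    Cond 15 (Cond 16 (Cond 17 cross_constraint skip) skip) skip ;;
    Block [Sub 15 11 13] ;;
    Cond 15 (Cond 17 nest_constraint skip) skip ;;
    Block [Add 9 9 1, Add 9 9 1, Add 10 10 1, Add 10 10 1, Add 10 10 1, Add 10 10 1, Sub 8 8 1]"

definition scan_body :: com where
  "scan_body =
    Block [Load 11 6, Add 15 6 1, Load 12 15, Copy 8 2, Const 9 32, Copy 10 3] ;;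
    While 8 pair_body ;;
    Block [Add 6 6 1, Add 6 6 1, Add 7 7 1, Add 7 7 1, Add 7 7 1, Add 7 7 1, Sub 5 5 1]"

text \<open>All ordered pairs are visited, since \<open>crosses\<close> and \<open>nested\<close>
  are not symmetric; a line paired with itself yields no constraint.\<close>

definition scan :: com where
  "scan = Block [Copy 5 2, Const 6 32, Copy 7 3] ;; While 5 scan_body"

text \<open>A literal and its negation occupy adjacent cells, which leaves two comparisons per
  line.\<close>

definition check_labels :: com where
  "check_labels = Block [Const 0 1, Add 22 2 2, Copy 23 3] ;;
    While 22
      (Block [Load 24 23, Add 23 23 1, Load 25 23, Add 23 23 1,
         Sub 26 24 25, Sub 24 25 24, Add 24 24 26, Sub 22 22 1] ;;
       Cond 24 skip (Block [Const 0 0]))"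

text \<open>The last loop stores in each label cell its own address, so that all labels start out
  distinct.\<close>

definition read_input :: com where
  "read_input = Block [Read 15, Read 2, Const 1 1, Copy 22 2, Const 23 32] ;;
    While 22 (Block [Read 15, Store 23 15, Add 23 23 1, Read 15, Store 23 15, Add 23 23 1,
      Sub 22 22 1]) ;;
    Block [Copy 3 23, Add 4 2 2, Add 4 4 4, Copy 22 4] ;;
    While 22 (Block [Store 23 23, Add 23 23 1, Sub 22 22 1])"

section \<open>Correctness of the loops\<close>

lemma wp_pair_body:
  assumes mem: "memory ls C R" and C: "C \<subseteq> all_constraints ls"
    and ij: "i < length ls" "j < length ls"
    and R: "R 7 = R 3 + 4 * i" "R 8 = length ls - j" "R 9 = 32 + 2 * j" "R 10 = R 3 + 4 * j"
      "R 11 = fst (ls ! i)" "R 12 = snd (ls ! i)"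
    and post: "\<And>R'. memory ls (C \<union> constraints ls i j) R' \<Longrightarrow>
      \<forall>r. r < 8 \<or> r = 11 \<or> r = 12 \<longrightarrow> R' r = R r \<Longrightarrow>
      R' 8 = length ls - Suc j \<Longrightarrow> R' 9 = 32 + 2 * Suc j \<Longrightarrow> R' 10 = R 3 + 4 * Suc j \<Longrightarrow> Q (R', w)"
  shows "wp pair_body (176 * length ls + 60) Q (R, w)"
proof -
  let ?l = "ls ! i" and ?l' = "ls ! j"
  let ?X = "if crosses ?l ?l' then {(4 * i + 2, 4 * j), (4 * i + 3, 4 * j + 1)} else {}"
  let ?N = "if nested ?l ?l' then {(4 * i, 4 * i + 3), (4 * i + 1, 4 * i + 2)} else {}"
  have con: "constraints ls i j = ?X \<union> ?N"
    by (simp add: constraints_def)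
  have sub: "constraints ls i j \<subseteq> all_constraints ls"
    using ij by (auto simp: all_constraints_def)
  have m: "R 1 = 1" "R (32 + 2 * j) = fst ?l'" "R (33 + 2 * j) = snd ?l'"
    using mem ij by (auto simp: memory_def)
  let ?fst = "[Load 13 9, Add 15 9 1, Load 14 15, Sub 15 13 11, Sub 16 12 13, Sub 17 14 12]"
  define R1 where "R1 = fst (fold exec ?fst (R, w))"
  have exec_R1: "fold exec ?fst (R, w) = (R1, w)"
    by (simp add: R1_def)
  have R1: "R1 13 = fst ?l'" "R1 15 = fst ?l' - fst ?l" "R1 16 = snd ?l - fst ?l'"
    "R1 17 = snd ?l' - snd ?l" "\<forall>r<13. R1 r = R r"
    using m R by (auto simp: R1_def)
  have mem1: "memory ls C R1" by (rule memory_cong[OF mem]) (auto simp: R1_def)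
  \<comment> \<open>\<open>Q1\<close> and \<open>Q2\<close> hold after the crossing and the nesting
    test; register 15 is exempt because it is reassigned in between.\<close>
  define Q1 where "Q1 = (\<lambda>(R', w'). w' = w \<and> memory ls (C \<union> ?X) R' \<and> (\<forall>r<18. r \<noteq> 15 \<longrightarrow> R' r = R1 r))"
  define Q2 where "Q2 = (\<lambda>(R', w'). w' = w \<and> memory ls (C \<union> constraints ls i j) R' \<and>
    (\<forall>r<18. r \<noteq> 15 \<longrightarrow> R' r = R1 r))"
  have skip1: "wp skip T Q1 (R1, w)" if "\<not> crosses ?l ?l'" for T
    using that mem1 by (intro wp_Block) (auto simp: Q1_def)
  have cross1: "wp cross_constraint (88 * length ls + 15) Q1 (R1, w)" if "crosses ?l ?l'"
  proof (rule wp_cross_constraint[OF mem1 C, of i j])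
    show "(4 * i + 2, 4 * j) \<in> all_constraints ls" "(4 * i + 3, 4 * j + 1) \<in> all_constraints ls"
      using that sub con by auto
  qed (use that R R1(5) in \<open>auto simp: Q1_def\<close>)
  have 1: "wp (Cond 15 (Cond 16 (Cond 17 cross_constraint skip) skip) skip)
      (88 * length ls + 15 + 2 + 2 + 2) Q1 (R1, w)"
    by (intro wp_Cond)
      (use R1 cross1 skip1 in \<open>auto simp: crosses_def\<close>)
  have 2: "wp (Cond 15 (Cond 17 nest_constraint skip) skip) (88 * length ls + 16 + 2 + 2) Q2
      (fold exec [Sub 15 11 13] s)" if q: "Q1 s" for s
  proof -
    obtain R' where s: "s = (R', w)" and mem': "memory ls (C \<union> ?X) R'"
      and R': "\<forall>r<18. r \<noteq> 15 \<longrightarrow> R' r = R1 r"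
      using q by (cases s) (auto simp: Q1_def)
    let ?R2 = "R'(15 := R' 11 - R' 13)"
    have mem2: "memory ls (C \<union> ?X) ?R2" by (rule memory_cong[OF mem']) auto
    have R2: "?R2 15 = fst ?l - fst ?l'" "?R2 17 = snd ?l' - snd ?l" "?R2 7 = ?R2 3 + 4 * i"
      using R' R R1 by auto
    have skip2: "wp skip T Q2 (?R2, w)" if "\<not> nested ?l ?l'" for T
      using that mem2 con R' by (intro wp_Block) (auto simp: Q2_def)
    have nest2: "wp nest_constraint (88 * length ls + 16) Q2 (?R2, w)" if "nested ?l ?l'"
    proof (rule wp_nest_constraint[OF mem2 _ R2(3)])
      show "(4 * i, 4 * i + 3) \<in> all_constraints ls" "(4 * i + 1, 4 * i + 2) \<in> all_constraints ls"
        using that sub con by auto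
      show "C \<union> ?X \<subseteq> all_constraints ls" using C sub con by blast
    next
      fix R'' assume "memory ls (C \<union> ?X \<union> {(4 * i, 4 * i + 3), (4 * i + 1, 4 * i + 2)}) R''"
        "\<forall>r<18. R'' r = ?R2 r"
      moreover have "C \<union> ?X \<union> {(4 * i, 4 * i + 3), (4 * i + 1, 4 * i + 2)} = C \<union> constraints ls i j"
        using that con by (simp add: Un_assoc)
      ultimately show "Q2 (R'', w)" using R' by (simp add: Q2_def)
    qed
    have "wp (Cond 15 (Cond 17 nest_constraint skip) skip) (88 * length ls + 16 + 2 + 2) Q2 (?R2, w)"
      by (intro wp_Cond)
        (use R2 nest2 skip2 in \<open>auto simp: nested_def\<close>)
    then show ?thesis by (simp add: s)
  qed
  let ?last = "[Add 9 9 1, Add 9 9 1, Add 10 10 1, Add 10 10 1, Add 10 10 1, Add 10 10 1, Sub 8 8 1]"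
  have 3: "wp (Block ?last) 7 Q s" if q: "Q2 s" for s
  proof -
    obtain R' where s: "s = (R', w)" and mem': "memory ls (C \<union> constraints ls i j) R'"
      and R': "\<forall>r<18. r \<noteq> 15 \<longrightarrow> R' r = R1 r"
      using q by (cases s) (auto simp: Q2_def)
    let ?R3 = "fst (fold exec ?last (R', w))"
    have eq: "\<forall>r<13. R' r = R r" using R' R1(5) by simp
    then have R'1: "R' 1 = 1" "R' 8 = length ls - j" "R' 9 = 32 + 2 * j" "R' 10 = R 3 + 4 * j"
      using m R by auto
    have "Q (?R3, w)"
    proof (rule post)
      show "memory ls (C \<union> constraints ls i j) ?R3" by (rule memory_cong[OF mem']) auto
    qed (use R'1 eq in auto)
    then show ?thesis unfolding s by (intro wp_Block) simp_all
  qed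
  have 4: "wp (Block [Sub 15 11 13] ;;
    Cond 15 (Cond 17 nest_constraint skip) skip ;; Block ?last) (1 + (88 * length ls + 16 + 2 + 2 + 7)) Q s"
    if "Q1 s" for s
    by (rule wp_Block_Seq[where T = "88 * length ls + 16 + 2 + 2 + 7"], simp, rule wp_Seq,
        rule wp_mono[OF 2[OF that]]) (use 3 in simp_all)
  show ?thesis
    unfolding pair_body_def
    by (rule wp_Block_Seq[where T = "(88 * length ls + 15 + 2 + 2 + 2) +
          (1 + (88 * length ls + 16 + 2 + 2 + 7))"], simp, rule wp_Seq)
      (use wp_mono[OF 1 order.refl 4] in \<open>simp_all only: exec_R1, simp_all\<close>)
qed

lemma wp_scan:
  assumes mem: "memory ls {} R"
    and post: "\<And>R'. memory ls (all_constraints ls) R' \<Longrightarrow> Q (R', w)"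
  shows "wp scan (length ls * (length ls * (176 * length ls + 62) + 16) + 4) Q (R, w)"
proof -
  let ?m = "length ls"
  \<comment> \<open>\<open>D i\<close> collects the completed rows, and \<open>E i j\<close> adds
    the first \<open>j\<close> pairs of row \<open>i\<close>; \<open>E_end\<close> passes from the
    inner to the outer loop.\<close>
  define D where "D i = (\<Union>i'<i. \<Union>j<?m. constraints ls i' j)" for i
  define E where "E i j = D i \<union> (\<Union>j'<j. constraints ls i j')" for i j
  have D_sub: "D i \<subseteq> all_constraints ls" if "i \<le> ?m" for i
    using that by (fastforce simp: D_def all_constraints_def)
  have E_sub: "E i j \<subseteq> all_constraints ls" if "i < ?m" "j \<le> ?m" for i j
    using that D_sub[of i] by (fastforce simp: E_def all_constraints_def)
  have E_Suc: "E i j \<union> constraints ls i j = E i (Suc j)" for i j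
    by (auto simp: E_def less_Suc_eq)
  have E_end: "E i ?m = D (Suc i)" for i
    by (auto simp: E_def D_def lessThan_Suc)
  define J where "J = (\<lambda>i (R, w'). w' = w \<and> memory ls (D i) R \<and> R 5 = ?m - i \<and> R 6 = 32 + 2 * i \<and>
    R 7 = R 3 + 4 * i)"
  define K where "K = (\<lambda>i j (R, w'). w' = w \<and> memory ls (E i j) R \<and> R 5 = ?m - i \<and> R 6 = 32 + 2 * i \<and>
    R 7 = R 3 + 4 * i \<and> R 8 = ?m - j \<and> R 9 = 32 + 2 * j \<and> R 10 = R 3 + 4 * j \<and>
    R 11 = fst (ls ! i) \<and> R 12 = snd (ls ! i))"
  have inner: "fst s 8 \<noteq> 0 \<and> wp pair_body (176 * ?m + 60) (K i (Suc j)) s"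
    if ij: "i < ?m" "j < ?m" "K i j s" for i j s
  proof -
    obtain R where s: "s = (R, w)" and mem: "memory ls (E i j) R"
      and R: "R 5 = ?m - i" "R 6 = 32 + 2 * i" "R 7 = R 3 + 4 * i" "R 8 = ?m - j" "R 9 = 32 + 2 * j"
        "R 10 = R 3 + 4 * j" "R 11 = fst (ls ! i)" "R 12 = snd (ls ! i)"
      using ij(3) by (cases s) (auto simp: K_def)
    have "wp pair_body (176 * ?m + 60) (K i (Suc j)) (R, w)"
      by (rule wp_pair_body[OF mem E_sub ij(1,2) R(3-8)])
        (use ij R in \<open>simp_all add: K_def E_Suc\<close>)
    then show ?thesis using R ij by (simp add: s)
  qed
  let ?fst = "[Load 11 6, Add 15 6 1, Load 12 15, Copy 8 2, Const 9 32, Copy 10 3]"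
  let ?last = "[Add 6 6 1, Add 6 6 1, Add 7 7 1, Add 7 7 1, Add 7 7 1, Add 7 7 1, Sub 5 5 1]"
  have body: "fst s 5 \<noteq> 0 \<and> wp scan_body (?m * (176 * ?m + 62) + 14) (J (Suc i)) s"
    if i: "i < ?m" "J i s" for i s
  proof -
    obtain R where s: "s = (R, w)" and mem: "memory ls (D i) R"
      and R: "R 5 = ?m - i" "R 6 = 32 + 2 * i" "R 7 = R 3 + 4 * i"
      using i(2) by (cases s) (auto simp: J_def)
    have m: "R 1 = 1" "R 2 = ?m" "R 3 = 32 + 2 * ?m" "R (32 + 2 * i) = fst (ls ! i)"
      "R (33 + 2 * i) = snd (ls ! i)"
      using mem i by (auto simp: memory_def)
    define R1 where "R1 = fst (fold exec ?fst (R, w))"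
    have exec_R1: "fold exec ?fst (R, w) = (R1, w)"
      by (simp add: R1_def)
    have "R1 5 = ?m - i" "R1 6 = 32 + 2 * i" "R1 7 = R1 3 + 4 * i" "R1 8 = ?m" "R1 9 = 32"
      "R1 10 = R1 3" "R1 11 = fst (ls ! i)" "R1 12 = snd (ls ! i)"
      using R m by (simp_all add: R1_def)
    moreover have "memory ls (E i 0) R1"
      by (rule memory_cong[of _ _ R]) (use mem in \<open>auto simp: E_def R1_def\<close>)
    ultimately have init: "K i 0 (R1, w)"
      by (simp add: K_def)
    have last: "wp (Block ?last) 7 (J (Suc i)) s'" if K: "K i ?m s'" for s'
    proof -
      obtain R' where s': "s' = (R', w)" and mem': "memory ls (E i ?m) R'"
        and R': "R' 5 = ?m - i" "R' 6 = 32 + 2 * i" "R' 7 = R' 3 + 4 * i"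
        using K by (cases s') (auto simp: K_def)
      have "R' 1 = 1" using mem' by (simp add: memory_def)
      moreover have "memory ls (D (Suc i)) (fst (fold exec ?last (R', w)))"
        unfolding E_end[symmetric] by (rule memory_cong[OF mem']) auto
      ultimately show ?thesis
        unfolding s' using R' by (intro wp_Block) (simp_all add: J_def)
    qed
    have exit: "fst s' 8 = 0 \<and> wp (Block ?last) 7 (J (Suc i)) s'" if "K i ?m s'" for s'
      using that last by (auto simp: K_def)
    have "wp (While 8 pair_body) (?m * (176 * ?m + 60 + 2) + 1) (wp (Block ?last) 7 (J (Suc i))) (R1, w)"
      by (rule wp_While[of ?m "K i", OF inner exit init]) (use i in auto)
    from wp_Seq[OF this]
    have "wp scan_body (?m * (176 * ?m + 62) + 14) (J (Suc i)) (R, w)"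
      unfolding scan_body_def
      by (intro wp_Block_Seq[where T = "?m * (176 * ?m + 60 + 2) + 1 + 7"]) (simp_all only: exec_R1, simp_all)
    then show ?thesis using R i by (simp add: s)
  qed
  have exit: "fst s 5 = 0 \<and> Q s" if "J ?m s" for s
  proof -
    have "D ?m = all_constraints ls" by (simp add: D_def all_constraints_def)
    then show ?thesis using that post by (cases s) (auto simp: J_def)
  qed
  let ?R = "fst (fold exec [Copy 5 2, Const 6 32, Copy 7 3] (R, w))"
  have "memory ls (D 0) ?R"
    by (rule memory_cong[of _ _ R]) (use mem in \<open>auto simp: D_def\<close>)
  then have init: "J 0 (?R, w)"
    using mem by (simp add: J_def memory_def)
  have "wp (While 5 scan_body) (?m * (?m * (176 * ?m + 62) + 14 + 2) + 1) Q (?R, w)"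
    by (rule wp_While[of ?m J, OF body exit init])
  then show ?thesis
    unfolding scan_def
    by (intro wp_Block_Seq[where T = "?m * (?m * (176 * ?m + 62) + 14 + 2) + 1"]) simp_all
qed

lemma wp_check_labels:
  assumes mem: "memory ls C R"
    and post: "\<And>R' w. (R' 0 \<noteq> 0 \<longleftrightarrow> (\<forall>k < 2 * length ls.
      R (32 + 2 * length ls + 2 * k) \<noteq> R (32 + 2 * length ls + (2 * k + 1)))) \<Longrightarrow> Q (R', w)"
  shows "wp check_labels (26 * length ls + 4) Q (R, w)"
proof -
  let ?m = "length ls"
  define lab where "lab k = R (32 + 2 * ?m + k)" for k
  \<comment> \<open>Register 0 is a running flag, initially 1 and cleared at the first
    coincidence.\<close>
  define J where "J = (\<lambda>i (R', w' :: nat list). R' 1 = 1 \<and> R' 22 = 2 * ?m - i \<and>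
    R' 23 = 32 + 2 * ?m + 2 * i \<and> (\<forall>k. R' (32 + 2 * ?m + k) = lab k) \<and>
    (R' 0 \<noteq> 0 \<longleftrightarrow> (\<forall>k<i. lab (2 * k) \<noteq> lab (2 * k + 1))))"
  let ?body = "Block [Load 24 23, Add 23 23 1, Load 25 23, Add 23 23 1,
         Sub 26 24 25, Sub 24 25 24, Add 24 24 26, Sub 22 22 1] ;;
       Cond 24 skip (Block [Const 0 0])"
  have body: "fst s 22 \<noteq> 0 \<and> wp ?body 11 (J (Suc i)) s" if i: "i < 2 * ?m" "J i s" for i s
  proof -
    obtain R' w' where s: "s = (R', w')" and R': "R' 1 = 1" "R' 22 = 2 * ?m - i"
      "R' 23 = 32 + 2 * ?m + 2 * i" "\<forall>k. R' (32 + 2 * ?m + k) = lab k"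
      "R' 0 \<noteq> 0 \<longleftrightarrow> (\<forall>k<i. lab (2 * k) \<noteq> lab (2 * k + 1))"
      using i(2) by (cases s) (auto simp: J_def)
    have cells: "R' (32 + 2 * ?m + 2 * i) = lab (2 * i)"
      "R' (Suc (32 + 2 * ?m + 2 * i)) = lab (Suc (2 * i))"
      using R'(4) by (simp, metis add_Suc_right)
    have "wp ?body 11 (J (Suc i)) (R', w')"
      apply (rule wp_Block_Seq[where T = "1 + 2"], simp)
       apply (rule wp_Cond; rule wp_Block; (simp; fail)?)
      using R' i cells by (auto simp: J_def less_Suc_eq)
    then show ?thesis using R' i by (simp add: s)
  qed
  have exit: "fst s 22 = 0 \<and> Q s" if "J (2 * ?m) s" for s
    using that post by (cases s) (auto simp: J_def lab_def)
  let ?R = "fst (fold exec [Const 0 1, Add 22 2 2, Copy 23 3] (R, w))"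
  have init: "J 0 (?R, w)"
    using mem by (simp add: J_def memory_def lab_def)
  have "wp (While 22 ?body) (2 * ?m * (11 + 2) + 1) Q (?R, w)"
    by (rule wp_While[of "2 * ?m" J, OF body exit init])
  then show ?thesis
    unfolding check_labels_def
    by (intro wp_Block_Seq[where T = "2 * ?m * (11 + 2) + 1"]) simp_all
qed

lemma wp_read_input:
  assumes post: "\<And>R' w'. memory ls {} R' \<Longrightarrow> Q (R', w')"
  shows "wp read_input (29 * length ls + 11) Q
    (\<lambda>_. 0, n # length ls # concat (map (\<lambda>(a, b). [a, b]) ls))"
proof -
  let ?m = "length ls"
  let ?enc = "\<lambda>ls. concat (map (\<lambda>(a, b). [a, b]) ls) :: nat list"
  let ?read = "[Read 15, Store 23 15, Add 23 23 1, Read 15, Store 23 15, Add 23 23 1, Sub 22 22 1]"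
  let ?mid = "[Copy 3 23, Add 4 2 2, Add 4 4 4, Copy 22 4]"
  let ?init = "[Store 23 23, Add 23 23 1, Sub 22 22 1]"
  \<comment> \<open>\<open>J\<close> belongs to the reading loop, where the unread input encodes the
    remaining lines, and \<open>K\<close> to the initialization of the labels.\<close>
  define J where "J = (\<lambda>i (R :: nat \<Rightarrow> nat, w). w = ?enc (drop i ls) \<and> R 1 = 1 \<and> R 2 = ?m \<and> R 22 = ?m - i \<and>
    R 23 = 32 + 2 * i \<and> (\<forall>k<i. R (32 + 2 * k) = fst (ls ! k) \<and> R (33 + 2 * k) = snd (ls ! k)))"
  define K where "K = (\<lambda>i (R :: nat \<Rightarrow> nat, w :: nat list). R 1 = 1 \<and> R 2 = ?m \<and> R 3 = 32 + 2 * ?m \<and> R 4 = 4 * ?m \<and>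
    R 22 = 4 * ?m - i \<and> R 23 = 32 + 2 * ?m + i \<and>
    (\<forall>k<?m. R (32 + 2 * k) = fst (ls ! k) \<and> R (33 + 2 * k) = snd (ls ! k)) \<and>
    (\<forall>k<i. R (32 + 2 * ?m + k) = 32 + 2 * ?m + k))"
  have body: "fst s 22 \<noteq> 0 \<and> wp (Block ?read) 7 (J (Suc i)) s" if i: "i < ?m" "J i s" for i s
  proof -
    obtain R where s: "s = (R, ?enc (drop i ls))" and R: "R 1 = 1" "R 2 = ?m" "R 22 = ?m - i"
      "R 23 = 32 + 2 * i" "\<forall>k<i. R (32 + 2 * k) = fst (ls ! k) \<and> R (33 + 2 * k) = snd (ls ! k)"
      using i(2) by (cases s) (auto simp: J_def)
    have w: "?enc (drop i ls) = fst (ls ! i) # snd (ls ! i) # ?enc (drop (Suc i) ls)"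
      using i by (simp add: Cons_nth_drop_Suc[symmetric] split: prod.split)
    have "wp (Block ?read) 7 (J (Suc i)) s"
      unfolding s w using R i
      by (intro wp_Block) (auto simp: J_def next_input_def less_Suc_eq)
    then show ?thesis using R i by (simp add: s)
  qed
  have body': "fst s 22 \<noteq> 0 \<and> wp (Block ?init) 3 (K (Suc i)) s" if i: "i < 4 * ?m" "K i s" for i s
  proof -
    obtain R w where s: "s = (R, w)" and R: "R 1 = 1" "R 2 = ?m" "R 3 = 32 + 2 * ?m" "R 4 = 4 * ?m"
      "R 22 = 4 * ?m - i" "R 23 = 32 + 2 * ?m + i"
      "\<forall>k<?m. R (32 + 2 * k) = fst (ls ! k) \<and> R (33 + 2 * k) = snd (ls ! k)"
      "\<forall>k<i. R (32 + 2 * ?m + k) = 32 + 2 * ?m + k"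
      using i(2) by (cases s) (auto simp: K_def)
    have "wp (Block ?init) 3 (K (Suc i)) s"
      unfolding s using R i
      by (intro wp_Block) (auto simp: K_def less_Suc_eq)
    then show ?thesis using R i by (simp add: s)
  qed
  have exit': "fst s 22 = 0 \<and> Q s" if "K (4 * ?m) s" for s
  proof -
    obtain R w where s: "s = (R, w)" by (cases s)
    \<comment> \<open>For no constraints, pairwise distinct labels suffice: equal labels then mean
      equal literals.\<close>
    have "labelling ls {} (\<lambda>k. R (32 + 2 * ?m + k))"
      using that by (simp add: labelling_def K_def s)
    then have "memory ls {} R" using that by (simp add: memory_def K_def s)
    then show ?thesis using that post by (auto simp: K_def s)
  qed
  have exit: "fst s 22 = 0 \<and> wp (Block ?mid ;; While 22 (Block ?init)) (4 + (4 * ?m * (3 + 2) + 1)) Q s"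
    if "J ?m s" for s
  proof -
    obtain R w where s: "s = (R, w)" by (cases s)
    have "K 0 (fold exec ?mid (R, w))"
      using that by (simp add: K_def J_def s)
    from wp_While[of "4 * ?m" K, OF body' exit' this]
    have "wp (Block ?mid ;; While 22 (Block ?init)) (4 + (4 * ?m * (3 + 2) + 1)) Q s"
      unfolding s by (intro wp_Block_Seq[where T = "4 * ?m * (3 + 2) + 1"]) simp_all
    then show ?thesis using that by (auto simp: J_def)
  qed
  let ?s = "fold exec [Read 15, Read 2, Const 1 1, Copy 22 2, Const 23 32]
    (\<lambda>_. 0, n # ?m # ?enc ls)"
  have "J 0 ?s" by (simp add: J_def next_input_def)
  from wp_Seq[OF wp_While[of ?m J, OF body exit this]] show ?thesis
    unfolding read_input_def
    by (intro wp_Block_Seq[where T = "?m * (7 + 2) + 1 + (4 + (4 * ?m * (3 + 2) + 1))"]) simp_all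
qed

theorem theorem1:
  shows "poly_time_decidable mlcm_instances encodes
    (\<lambda>(n, L). \<exists>\<phi>. is_layout n L \<phi> \<and> admissible n L \<phi> \<and> periphery_condition L \<phi> \<and>
      crossing_number n L \<phi> = 0)"
proof (rule poly_time_decidable_if_wp[where c = "read_input ;; scan ;; check_labels"
      and T = "[:19, 71, 62, 176:]"])
  fix x w
  assume x: "x \<in> mlcm_instances" and w: "encodes x w"
  obtain n L where nL: "x = (n, L)" by (cases x)
  obtain ls where ls: "distinct ls" "set ls = L"
    and w_eq: "w = n # length ls # concat (map (\<lambda>(a, b). [a, b]) ls)"
    using w by (auto simp: encodes_def nL)
  let ?m = "length ls"
  let ?Q = "\<exists>\<phi>. is_layout n L \<phi> \<and> admissible n L \<phi> \<and> periphery_condition L \<phi> \<and>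
      crossing_number n L \<phi> = 0"
  have "finite L" "\<forall>l\<in>L. is_line n l"
    using x by (auto simp: mlcm_instances_def nL)
  then have Q_iff: "?Q \<longleftrightarrow> (\<exists>x z. consistent (set ls) x z)"
    using consistent_if_layout layout_if_consistent ls(2) by blast
  \<comment> \<open>Every number takes at least one digit, so the number of lines is bounded by the
    input size.\<close>
  have length_le: "length v \<le> input_size v" for v
    unfolding input_size_def
  proof (induction v)
    case (Cons y v)
    then show ?case using bit_size_pos[of y] by simp
  qed simp
  have "length (concat (map (\<lambda>(a, b). [a, b]) ls)) = 2 * ?m"
    by (induction ls) auto
  then have m_le: "?m \<le> input_size w"
    using length_le[of w] by (simp add: w_eq)
  have check: "wp check_labels (26 * ?m + 4) (\<lambda>s. fst s 0 \<noteq> 0 \<longleftrightarrow> ?Q) (R, v)"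
    if "memory ls (all_constraints ls) R" for R v
    using labels_distinct_iff_consistent[OF ls(1), of "\<lambda>k. R (32 + 2 * ?m + k)"] that Q_iff
    by (intro wp_check_labels[OF that]) (simp add: memory_def)
  have scan: "wp scan (?m * (?m * (176 * ?m + 62) + 16) + 4)
      (wp check_labels (26 * ?m + 4) (\<lambda>s. fst s 0 \<noteq> 0 \<longleftrightarrow> ?Q)) (R, v)"
    if "memory ls {} R" for R v
    by (rule wp_scan[OF that]) (rule check)
  have "wp (read_input ;; scan ;; check_labels)
      (29 * ?m + 11 + (?m * (?m * (176 * ?m + 62) + 16) + 4 + (26 * ?m + 4)))
      (\<lambda>s. fst s 0 \<noteq> 0 \<longleftrightarrow> ?Q) (\<lambda>_. 0, w)"
    unfolding w_eq by (intro wp_Seq wp_read_input scan)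
  \<comment> \<open>The step bounds of the three phases add up to a cubic in the number of lines;
    its coefficients form the polynomial chosen at the start.\<close>
  moreover have "29 * ?m + 11 + (?m * (?m * (176 * ?m + 62) + 16) + 4 + (26 * ?m + 4)) =
      19 + ?m * (71 + ?m * (62 + ?m * 176))"
    by (simp add: algebra_simps)
  moreover have "\<dots> \<le> poly [:19, 71, 62, 176:] (input_size w)"
    using m_le by (auto intro!: add_mono mult_mono)
  ultimately show "wp (read_input ;; scan ;; check_labels) (poly [:19, 71, 62, 176:] (input_size w))
      (\<lambda>s. fst s 0 \<noteq> 0 \<longleftrightarrow> (case x of (n, L) \<Rightarrow> \<exists>\<phi>. is_layout n L \<phi> \<and> admissible n L \<phi> \<and>
        periphery_condition L \<phi> \<and> crossing_number n L \<phi> = 0)) (\<lambda>_. 0, w)"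
    unfolding nL prod.case by (elim wp_mono) simp_all
qed

end
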